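(* The systems $\mathcal{D}$ and $\mathcal{K}$ are equivalent: a sequent $\Gamma\vdash G$ has a proof in $\mathcal{D}$ if and only if it has a proof in $\mathcal{K}$.
   Context: Propositions are first-order formulas built from atomic propositions $P(t_1,\dots,t_k)$ (predicate symbol applied to terms; $\top,\bot$ are not atomic), $\top$, $\bot$, $\wedge$, $\vee$, $\Rightarrow$, $\forall$, $\exists$. Sequents are $\Gamma\vdash G$ with $\Gamma$ a finite multiset of propositions and $G$ a proposition; $t$ below ranges over arbitrary terms. Common rules of $\mathcal{K}$ and $\mathcal{D}$: axiom $\Gamma,P\vdash P$ ($P$ atomic); $\top$-right $\Gamma\vdash\top$; $\bot$-left $\Gamma,\bot\vdash G$; $\wedge$-left (from $\Gamma,A,B\vdash G$ infer $\Gamma,A\wedge B\vdash G$); $\wedge$-right (from $\Gamma\vdash A$, $\Gamma\vdash B$ infer $\Gamma\vdash A\wedge B$); $\vee$-left (from $\Gamma,A\vdash G$, $\Gamma,B\vdash G$ infer $\Gamma,A\vee B\vdash G$); $\vee$-right (from $\Gamma\vdash A$, or from $\Gamma\vdash B$, infer $\Gamma\vdash A\vee B$); $\Rightarrow$-right (from $\Gamma,A\vdash B$ infer $\Gamma\vdash A\Rightarrow B$); $\forall$-right (from $\Gamma\vdash A$ infer $\Gamma\vdash\forall x\,A$, $x$ not free in $\Gamma$); contr-$\forall$-left (from $\Gamma,\forall x\,A,(t/x)A\vdash G$ infer $\Gamma,\forall x\,A\vdash G$); $\exists$-left (from $\Gamma,A\vdash G$ infer $\Gamma,\exists x\,A\vdash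 G$, $x$ not free in $\Gamma,G$); $\exists$-right (from $\Gamma\vdash(t/x)A$ infer $\Gamma\vdash\exists x\,A$). $\mathcal{K}$ consists of these rules plus contr-$\Rightarrow$-left (from $\Gamma,A\Rightarrow B\vdash A$ and $\Gamma,B\vdash G$ infer $\Gamma,A\Rightarrow B\vdash G$). $\mathcal{D}$ consists of the common rules plus: $\Rightarrow$-left$_{axiom}$ (from $\Gamma,P,B\vdash G$ infer $\Gamma,P,P\Rightarrow B\vdash G$, $P$ atomic); $\Rightarrow$-left$_\top$ (from $\Gamma,B\vdash G$ infer $\Gamma,\top\Rightarrow B\vdash G$); $\Rightarrow$-left$_\wedge$ (from $\Gamma,C\Rightarrow B\vdash C$, $\Gamma,D\Rightarrow B\vdash D$, $\Gamma,B\vdash G$ infer $\Gamma,(C\wedge D)\Rightarrow B\vdash G$); two $\Rightarrow$-left$_\vee$ rules (from $\Gamma,C\Rightarrow B,D\Rightarrow B\vdash C$ and $\Gamma,B\vdash G$, resp. from $\Gamma,C\Rightarrow B,D\Rightarrow B\vdash D$ and $\Gamma,B\vdash G$, infer $\Gamma,(C\vee D)\Rightarrow B\vdash G$); $\Rightarrow$-left$_\Rightarrow$ (from $\Gamma,D\Rightarrow B,C\vdash D$ and $\Gamma,B\vdash G$ infer $\Gamma,(C\Rightarrow D)\Rightarrow B\vdash G$); $\Rightarrow$-left$_\forall$ (from $\Gamma,(\forall x\,C)\Rightarrow B\vdash C$ and $\Gamma,B\vdash G$ infer $\Gamma,(\forall x\,C)\Rightarrow B\vdash G$, $x$ not free in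 $\Gamma,B$); $\Rightarrow$-left$_\exists$ (from $\Gamma,(\exists x\,C)\Rightarrow B\vdash(t/x)C$ and $\Gamma,B\vdash G$ infer $\Gamma,(\exists x\,C)\Rightarrow B\vdash G$). *)

theory Defs
  imports Main "HOL-Library.Multiset"
begin

text \<open>
  Propositions are identified up to renaming of bound variables. Alpha-equivalence classes are
  represented by de Bruijn terms: variables are natural numbers, and under \<open>k\<close> quantifiers the
  index \<open>k + n\<close> denotes the variable \<open>n\<close>. The usual notation with named variables is recovered by
  the operations \<open>all x A\<close>, \<open>ex x A\<close> and \<open>inst t x A\<close> below, and the inference rules are stated
  with these only.
\<close>

datatype 'f tm = Var nat | Fun 'f "'f tm list"

datatype ('f, 'p) fm =
    Atom 'p "'f tm list"
  | Top
  | Bot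
  | Conj "('f, 'p) fm" "('f, 'p) fm" (infixr \<open>\<^bold>\<and>\<close> 75)
  | Disj "('f, 'p) fm" "('f, 'p) fm" (infixr \<open>\<^bold>\<or>\<close> 73)
  | Imp "('f, 'p) fm" "('f, 'p) fm" (infixr \<open>\<^bold>\<Rightarrow>\<close> 71)
  | Forall "('f, 'p) fm"
  | Exists "('f, 'p) fm"

text \<open>
  A language is given by its function and predicate symbols, each paired with its arity.
\<close>

primrec wf_tm :: "('f \<times> nat) set \<Rightarrow> 'f tm \<Rightarrow> bool" where
  "wf_tm F (Var n) = True"
| "wf_tm F (Fun f ts) = ((f, length ts) \<in> F \<and> list_all (wf_tm F) ts)"

primrec wf_fm :: "('f \<times> nat) set \<Rightarrow> ('p \<times> nat) set \<Rightarrow> ('f, 'p) fm \<Rightarrow> bool" where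
  "wf_fm F P (Atom p ts) = ((p, length ts) \<in> P \<and> list_all (wf_tm F) ts)"
| "wf_fm F P Top = True"
| "wf_fm F P Bot = True"
| "wf_fm F P (A \<^bold>\<and> B) = (wf_fm F P A \<and> wf_fm F P B)"
| "wf_fm F P (A \<^bold>\<or> B) = (wf_fm F P A \<and> wf_fm F P B)"
| "wf_fm F P (A \<^bold>\<Rightarrow> B) = (wf_fm F P A \<and> wf_fm F P B)"
| "wf_fm F P (Forall A) = wf_fm F P A"
| "wf_fm F P (Exists A) = wf_fm F P A"

primrec fv_tm :: "'f tm \<Rightarrow> nat set" where
  "fv_tm (Var n) = {n}"
| "fv_tm (Fun f ts) = \<Union> (set (map fv_tm ts))"

primrec fv :: "('f, 'p) fm \<Rightarrow> nat set" where
  "fv (Atom p ts) = (\<Union>t\<in>set ts. fv_tm t)"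
| "fv Top = {}"
| "fv Bot = {}"
| "fv (A \<^bold>\<and> B) = fv A \<union> fv B"
| "fv (A \<^bold>\<or> B) = fv A \<union> fv B"
| "fv (A \<^bold>\<Rightarrow> B) = fv A \<union> fv B"
| "fv (Forall A) = {n. Suc n \<in> fv A}"
| "fv (Exists A) = {n. Suc n \<in> fv A}"

definition fv_ctx :: "('f, 'p) fm multiset \<Rightarrow> nat set" where
  "fv_ctx \<Gamma> = (\<Union>A\<in>set_mset \<Gamma>. fv A)"

primrec subst_tm :: "(nat \<Rightarrow> 'f tm) \<Rightarrow> 'f tm \<Rightarrow> 'f tm" where
  "subst_tm s (Var n) = s n"
| "subst_tm s (Fun f ts) = Fun f (map (subst_tm s) ts)"

definition lift_subst :: "(nat \<Rightarrow> 'f tm) \<Rightarrow> nat \<Rightarrow> 'f tm" where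
  "lift_subst s n = (case n of 0 \<Rightarrow> Var 0 | Suc m \<Rightarrow> subst_tm (\<lambda>i. Var (Suc i)) (s m))"

primrec subst_fm :: "(nat \<Rightarrow> 'f tm) \<Rightarrow> ('f, 'p) fm \<Rightarrow> ('f, 'p) fm" where
  "subst_fm s (Atom p ts) = Atom p (map (subst_tm s) ts)"
| "subst_fm s Top = Top"
| "subst_fm s Bot = Bot"
| "subst_fm s (A \<^bold>\<and> B) = subst_fm s A \<^bold>\<and> subst_fm s B"
| "subst_fm s (A \<^bold>\<or> B) = subst_fm s A \<^bold>\<or> subst_fm s B"
| "subst_fm s (A \<^bold>\<Rightarrow> B) = (subst_fm s A \<^bold>\<Rightarrow> subst_fm s B)"
| "subst_fm s (Forall A) = Forall (subst_fm (lift_subst s) A)"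
| "subst_fm s (Exists A) = Exists (subst_fm (lift_subst s) A)"

definition bind :: "nat \<Rightarrow> ('f, 'p) fm \<Rightarrow> ('f, 'p) fm" where
  "bind x A = subst_fm (\<lambda>n. if n = x then Var 0 else Var (Suc n)) A"

text \<open>
  \<open>all x A\<close> and \<open>ex x A\<close> are the quantifications of the named variable \<open>x\<close> in \<open>A\<close>, and
  \<open>inst t x A\<close> is the capture-avoiding substitution \<open>(t/x)A\<close>.
\<close>

definition all :: "nat \<Rightarrow> ('f, 'p) fm \<Rightarrow> ('f, 'p) fm" where
  "all x A = Forall (bind x A)"

definition ex :: "nat \<Rightarrow> ('f, 'p) fm \<Rightarrow> ('f, 'p) fm" where
  "ex x A = Exists (bind x A)"

definition inst :: "'f tm \<Rightarrow> nat \<Rightarrow> ('f, 'p) fm \<Rightarrow> ('f, 'p) fm" where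
  "inst t x A = subst_fm (Var(x := t)) A"

text \<open>
  The facts \<open>fv_all\<close>, \<open>all_alpha\<close>, \<open>inst_all\<close> and \<open>Forall_is_all\<close> (and their counterparts for
  \<open>ex\<close>) confirm that these operations obey the laws of named syntax modulo alpha-equivalence.
\<close>

lemma subst_tm_cong: "(\<And>n. n \<in> fv_tm t \<Longrightarrow> s n = s' n) \<Longrightarrow> subst_tm s t = subst_tm s' t"
  by (induction t) auto

lemma lift_subst_cong:
  "(\<And>n. Suc n \<in> M \<Longrightarrow> s n = s' n) \<Longrightarrow> m \<in> M \<Longrightarrow> lift_subst s m = lift_subst s' m"
  by (cases m) (simp_all add: lift_subst_def)

lemma subst_fm_cong: "(\<And>n. n \<in> fv A \<Longrightarrow> s n = s' n) \<Longrightarrow> subst_fm s A = subst_fm s' A"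
proof (induction A arbitrary: s s')
  case (Atom p ts)
  then show ?case by (auto intro!: subst_tm_cong)
next
  case (Conj A B)
  have "subst_fm s A = subst_fm s' A" by (rule Conj.IH(1)) (simp add: Conj.prems)
  moreover have "subst_fm s B = subst_fm s' B" by (rule Conj.IH(2)) (simp add: Conj.prems)
  ultimately show ?case by simp
next
  case (Disj A B)
  have "subst_fm s A = subst_fm s' A" by (rule Disj.IH(1)) (simp add: Disj.prems)
  moreover have "subst_fm s B = subst_fm s' B" by (rule Disj.IH(2)) (simp add: Disj.prems)
  ultimately show ?case by simp
next
  case (Imp A B)
  have "subst_fm s A = subst_fm s' A" by (rule Imp.IH(1)) (simp add: Imp.prems)
  moreover have "subst_fm s B = subst_fm s' B" by (rule Imp.IH(2)) (simp add: Imp.prems)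
  ultimately show ?case by simp
next
  case (Forall A)
  have "subst_fm (lift_subst s) A = subst_fm (lift_subst s') A"
    by (rule Forall.IH, rule lift_subst_cong[of "fv A"]) (simp_all add: Forall.prems)
  then show ?case by simp
next
  case (Exists A)
  have "subst_fm (lift_subst s) A = subst_fm (lift_subst s') A"
    by (rule Exists.IH, rule lift_subst_cong[of "fv A"]) (simp_all add: Exists.prems)
  then show ?case by simp
qed simp_all

lemma subst_tm_comp: "subst_tm s (subst_tm s' t) = subst_tm (\<lambda>n. subst_tm s (s' n)) t"
  by (induction t) auto

lemma lift_subst_comp:
  "(\<lambda>n. subst_tm (lift_subst s) (lift_subst s' n)) = lift_subst (\<lambda>n. subst_tm s (s' n))"
  by (rule ext) (auto simp: lift_subst_def subst_tm_comp split: nat.split)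

lemma subst_fm_comp: "subst_fm s (subst_fm s' A) = subst_fm (\<lambda>n. subst_tm s (s' n)) A"
  by (induction A arbitrary: s s') (auto simp: lift_subst_comp subst_tm_comp)

lemma subst_tm_Var: "subst_tm Var t = t"
  by (induction t) (auto simp: map_idI)

lemma lift_subst_Var: "lift_subst Var = Var"
  by (rule ext) (auto simp: lift_subst_def split: nat.split)

lemma subst_fm_Var: "subst_fm Var A = A"
  by (induction A) (auto simp: lift_subst_Var subst_tm_Var map_idI)

lemma fv_subst_tm: "fv_tm (subst_tm s t) = (\<Union>n\<in>fv_tm t. fv_tm (s n))"
  by (induction t) auto

lemma fv_lift_subst: "{n. Suc n \<in> (\<Union>m\<in>M. fv_tm (lift_subst s m))} = (\<Union>m\<in>{m. Suc m \<in> M}. fv_tm (s m))"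
proof (intro set_eqI iffI)
  fix n assume "n \<in> {n. Suc n \<in> (\<Union>m\<in>M. fv_tm (lift_subst s m))}"
  then obtain m where m: "m \<in> M" "Suc n \<in> fv_tm (lift_subst s m)" by auto
  then show "n \<in> (\<Union>m\<in>{m. Suc m \<in> M}. fv_tm (s m))"
    by (cases m) (auto simp: lift_subst_def fv_subst_tm)
next
  fix n assume "n \<in> (\<Union>m\<in>{m. Suc m \<in> M}. fv_tm (s m))"
  then obtain m where "Suc m \<in> M" "n \<in> fv_tm (s m)" by auto
  then show "n \<in> {n. Suc n \<in> (\<Union>m\<in>M. fv_tm (lift_subst s m))}"
    by (auto simp: lift_subst_def fv_subst_tm intro!: bexI[of _ "Suc m"])
qed

lemma fv_subst_fm: "fv (subst_fm s A) = (\<Union>n\<in>fv A. fv_tm (s n))"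
  by (induction A arbitrary: s) (simp_all add: fv_subst_tm fv_lift_subst[simplified] UN_Un)

lemma fv_all: "fv (all x A) = fv A - {x}"
  by (auto simp: all_def bind_def fv_subst_fm split: if_splits)

lemma fv_ex: "fv (ex x A) = fv A - {x}"
  by (auto simp: ex_def bind_def fv_subst_fm split: if_splits)

lemma bind_alpha: "y \<notin> fv A \<Longrightarrow> bind y (inst (Var y) x A) = bind x A"
  by (auto simp: bind_def inst_def subst_fm_comp intro!: subst_fm_cong)

lemma all_alpha: "y \<notin> fv A \<Longrightarrow> all y (inst (Var y) x A) = all x A"
  by (simp add: all_def bind_alpha)

lemma ex_alpha: "y \<notin> fv A \<Longrightarrow> ex y (inst (Var y) x A) = ex x A"
  by (simp add: ex_def bind_alpha)

lemma inst_bind: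
  assumes "y \<noteq> x" "y \<notin> fv_tm t"
  shows "subst_fm (lift_subst (Var(x := t))) (bind y A) = bind y (inst t x A)"
  unfolding bind_def inst_def subst_fm_comp
  using assms by (intro subst_fm_cong) (auto simp: lift_subst_def intro!: subst_tm_cong)

lemma inst_all: "y \<noteq> x \<Longrightarrow> y \<notin> fv_tm t \<Longrightarrow> inst t x (all y A) = all y (inst t x A)"
  using inst_bind[of y x t A] by (simp add: all_def inst_def)

lemma inst_ex: "y \<noteq> x \<Longrightarrow> y \<notin> fv_tm t \<Longrightarrow> inst t x (ex y A) = ex y (inst t x A)"
  using inst_bind[of y x t A] by (simp add: ex_def inst_def)

lemma bind_surj:
  assumes "Suc x \<notin> fv B"
  shows "B = bind x (subst_fm (\<lambda>n. case n of 0 \<Rightarrow> Var x | Suc m \<Rightarrow> Var m) B)"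
proof -
  have "bind x (subst_fm (\<lambda>n. case n of 0 \<Rightarrow> Var x | Suc m \<Rightarrow> Var m) B) = subst_fm Var B"
    unfolding bind_def subst_fm_comp
    using assms by (intro subst_fm_cong) (auto split: nat.split)
  then show ?thesis by (simp add: subst_fm_Var)
qed

lemma Forall_is_all: "x \<notin> fv (Forall B) \<Longrightarrow> \<exists>A. Forall B = all x A"
  using bind_surj[of x B] by (auto simp: all_def)

lemma Exists_is_ex: "x \<notin> fv (Exists B) \<Longrightarrow> \<exists>A. Exists B = ex x A"
  using bind_surj[of x B] by (auto simp: ex_def)

text \<open>
  The terms instantiating quantifiers are those of the language with function symbols \<open>F\<close>.
  All other propositions in the premises of a rule are obtained from subformulas of its
  conclusion, so a derivation of a well-formed sequent consists of well-formed sequents.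
\<close>

inductive derivK :: "('f \<times> nat) set \<Rightarrow> ('f, 'p) fm multiset \<Rightarrow> ('f, 'p) fm \<Rightarrow> bool"
  for F :: "('f \<times> nat) set" where
  K_axiom: "derivK F (add_mset (Atom p ts) \<Gamma>) (Atom p ts)"
| K_TopR: "derivK F \<Gamma> Top"
| K_BotL: "derivK F (add_mset Bot \<Gamma>) G"
| K_ConjL: "derivK F (add_mset A (add_mset B \<Gamma>)) G \<Longrightarrow> derivK F (add_mset (A \<^bold>\<and> B) \<Gamma>) G"
| K_ConjR: "derivK F \<Gamma> A \<Longrightarrow> derivK F \<Gamma> B \<Longrightarrow> derivK F \<Gamma> (A \<^bold>\<and> B)"
| K_DisjL: "derivK F (add_mset A \<Gamma>) G \<Longrightarrow> derivK F (add_mset B \<Gamma>) G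
    \<Longrightarrow> derivK F (add_mset (A \<^bold>\<or> B) \<Gamma>) G"
| K_DisjR1: "derivK F \<Gamma> A \<Longrightarrow> derivK F \<Gamma> (A \<^bold>\<or> B)"
| K_DisjR2: "derivK F \<Gamma> B \<Longrightarrow> derivK F \<Gamma> (A \<^bold>\<or> B)"
| K_ImpR: "derivK F (add_mset A \<Gamma>) B \<Longrightarrow> derivK F \<Gamma> (A \<^bold>\<Rightarrow> B)"
| K_AllR: "derivK F \<Gamma> A \<Longrightarrow> x \<notin> fv_ctx \<Gamma> \<Longrightarrow> derivK F \<Gamma> (all x A)"
| K_AllL: "derivK F (add_mset (all x A) (add_mset (inst t x A) \<Gamma>)) G \<Longrightarrow> wf_tm F t
    \<Longrightarrow> derivK F (add_mset (all x A) \<Gamma>) G"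
| K_ExL: "derivK F (add_mset A \<Gamma>) G \<Longrightarrow> x \<notin> fv_ctx \<Gamma> \<union> fv G
    \<Longrightarrow> derivK F (add_mset (ex x A) \<Gamma>) G"
| K_ExR: "derivK F \<Gamma> (inst t x A) \<Longrightarrow> wf_tm F t \<Longrightarrow> derivK F \<Gamma> (ex x A)"
| K_ImpL: "derivK F (add_mset (A \<^bold>\<Rightarrow> B) \<Gamma>) A \<Longrightarrow> derivK F (add_mset B \<Gamma>) G
    \<Longrightarrow> derivK F (add_mset (A \<^bold>\<Rightarrow> B) \<Gamma>) G"

inductive derivD :: "('f \<times> nat) set \<Rightarrow> ('f, 'p) fm multiset \<Rightarrow> ('f, 'p) fm \<Rightarrow> bool"
  for F :: "('f \<times> nat) set" where
  D_axiom: "derivD F (add_mset (Atom p ts) \<Gamma>) (Atom p ts)"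
| D_TopR: "derivD F \<Gamma> Top"
| D_BotL: "derivD F (add_mset Bot \<Gamma>) G"
| D_ConjL: "derivD F (add_mset A (add_mset B \<Gamma>)) G \<Longrightarrow> derivD F (add_mset (A \<^bold>\<and> B) \<Gamma>) G"
| D_ConjR: "derivD F \<Gamma> A \<Longrightarrow> derivD F \<Gamma> B \<Longrightarrow> derivD F \<Gamma> (A \<^bold>\<and> B)"
| D_DisjL: "derivD F (add_mset A \<Gamma>) G \<Longrightarrow> derivD F (add_mset B \<Gamma>) G
    \<Longrightarrow> derivD F (add_mset (A \<^bold>\<or> B) \<Gamma>) G"
| D_DisjR1: "derivD F \<Gamma> A \<Longrightarrow> derivD F \<Gamma> (A \<^bold>\<or> B)"
| D_DisjR2: "derivD F \<Gamma> B \<Longrightarrow> derivD F \<Gamma> (A \<^bold>\<or> B)"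
| D_ImpR: "derivD F (add_mset A \<Gamma>) B \<Longrightarrow> derivD F \<Gamma> (A \<^bold>\<Rightarrow> B)"
| D_AllR: "derivD F \<Gamma> A \<Longrightarrow> x \<notin> fv_ctx \<Gamma> \<Longrightarrow> derivD F \<Gamma> (all x A)"
| D_AllL: "derivD F (add_mset (all x A) (add_mset (inst t x A) \<Gamma>)) G \<Longrightarrow> wf_tm F t
    \<Longrightarrow> derivD F (add_mset (all x A) \<Gamma>) G"
| D_ExL: "derivD F (add_mset A \<Gamma>) G \<Longrightarrow> x \<notin> fv_ctx \<Gamma> \<union> fv G
    \<Longrightarrow> derivD F (add_mset (ex x A) \<Gamma>) G"
| D_ExR: "derivD F \<Gamma> (inst t x A) \<Longrightarrow> wf_tm F t \<Longrightarrow> derivD F \<Gamma> (ex x A)"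
| D_ImpL_axiom: "derivD F (add_mset (Atom p ts) (add_mset B \<Gamma>)) G
    \<Longrightarrow> derivD F (add_mset (Atom p ts) (add_mset (Atom p ts \<^bold>\<Rightarrow> B) \<Gamma>)) G"
| D_ImpL_Top: "derivD F (add_mset B \<Gamma>) G \<Longrightarrow> derivD F (add_mset (Top \<^bold>\<Rightarrow> B) \<Gamma>) G"
| D_ImpL_Conj: "derivD F (add_mset (C \<^bold>\<Rightarrow> B) \<Gamma>) C \<Longrightarrow> derivD F (add_mset (E \<^bold>\<Rightarrow> B) \<Gamma>) E
    \<Longrightarrow> derivD F (add_mset B \<Gamma>) G \<Longrightarrow> derivD F (add_mset ((C \<^bold>\<and> E) \<^bold>\<Rightarrow> B) \<Gamma>) G"
| D_ImpL_Disj1: "derivD F (add_mset (C \<^bold>\<Rightarrow> B) (add_mset (E \<^bold>\<Rightarrow> B) \<Gamma>)) C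
    \<Longrightarrow> derivD F (add_mset B \<Gamma>) G \<Longrightarrow> derivD F (add_mset ((C \<^bold>\<or> E) \<^bold>\<Rightarrow> B) \<Gamma>) G"
| D_ImpL_Disj2: "derivD F (add_mset (C \<^bold>\<Rightarrow> B) (add_mset (E \<^bold>\<Rightarrow> B) \<Gamma>)) E
    \<Longrightarrow> derivD F (add_mset B \<Gamma>) G \<Longrightarrow> derivD F (add_mset ((C \<^bold>\<or> E) \<^bold>\<Rightarrow> B) \<Gamma>) G"
| D_ImpL_Imp: "derivD F (add_mset (E \<^bold>\<Rightarrow> B) (add_mset C \<Gamma>)) E
    \<Longrightarrow> derivD F (add_mset B \<Gamma>) G \<Longrightarrow> derivD F (add_mset ((C \<^bold>\<Rightarrow> E) \<^bold>\<Rightarrow> B) \<Gamma>) G"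
| D_ImpL_All: "derivD F (add_mset (all x C \<^bold>\<Rightarrow> B) \<Gamma>) C \<Longrightarrow> derivD F (add_mset B \<Gamma>) G
    \<Longrightarrow> x \<notin> fv_ctx \<Gamma> \<union> fv B \<Longrightarrow> derivD F (add_mset (all x C \<^bold>\<Rightarrow> B) \<Gamma>) G"
| D_ImpL_Ex: "derivD F (add_mset (ex x C \<^bold>\<Rightarrow> B) \<Gamma>) (inst t x C) \<Longrightarrow> wf_tm F t
    \<Longrightarrow> derivD F (add_mset B \<Gamma>) G \<Longrightarrow> derivD F (add_mset (ex x C \<^bold>\<Rightarrow> B) \<Gamma>) G"

end

theory Submission
  imports Defs
begin

text \<open>
  Both calculi are compared through variants in which the eigenvariable premise of \<open>\<forall>\<close>-right,
  \<open>\<exists>\<close>-left and \<open>\<Rightarrow>\<close>-left\<open>\<^sub>\<forall>\<close> is replaced by one premise for every term of the language. These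
  prove the same sequents: an eigenvariable derivation can be substituted, and conversely the
  instance at a fresh variable suffices. The structural arguments then need no renaming.

  From \<open>\<K>\<close> to \<open>\<D>\<close>: contraction of \<open>A\<close> and admissibility in \<open>\<D>\<close> of contr-\<open>\<Rightarrow>\<close>-left with antecedent
  \<open>A\<close> are proved simultaneously by induction on the size of \<open>A\<close>. For the latter, the derivation of
  \<open>\<Gamma>, A \<Rightarrow> B \<turnstile> A\<close> is followed upwards through left rules, whose side premises are invertible, until
  a right rule introduces \<open>A\<close>; there the matching left rule of \<open>\<D>\<close> applies once the hypothesis
  \<open>A \<Rightarrow> B\<close> is replaced by those which that rule puts in its place, such as \<open>C \<Rightarrow> B\<close> for
  \<open>(C \<and> E) \<Rightarrow> B\<close>.

  From \<open>\<D>\<close> to \<open>\<K>\<close>: the rules of \<open>\<D>\<close> are derivable in \<open>\<K>\<close> only with cuts. Instead of eliminating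
  them, \<open>\<D>\<close> is interpreted in a model whose worlds are the contexts of \<open>\<K>\<close>, with disjunction and
  existence interpreted up to a closure operator. In this model \<open>A\<close> forces \<open>A\<close>, and every context
  that forces \<open>A\<close> derives \<open>A\<close> in \<open>\<K>\<close>.
\<close>

section \<open>Formula size, instances of quantifier bodies, and fresh variables\<close>

primrec fsize :: "('f, 'p) fm \<Rightarrow> nat" where
  "fsize (Atom p ts) = 1"
| "fsize Top = 1"
| "fsize Bot = 1"
| "fsize (A \<^bold>\<and> B) = Suc (fsize A + fsize B)"
| "fsize (A \<^bold>\<or> B) = Suc (fsize A + fsize B)"
| "fsize (A \<^bold>\<Rightarrow> B) = Suc (fsize A + fsize B)"
| "fsize (Forall A) = Suc (fsize A)"
| "fsize (Exists A) = Suc (fsize A)"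

lemma fsize_subst_fm [simp]: "fsize (subst_fm s A) = fsize A"
  by (induction A arbitrary: s) auto

text \<open>Index 0 of a quantifier body is the bound variable; filling it directly allows
  quantifier rules without bound names. \<open>instance_fm_bind\<close> relates this to
  \<open>inst\<close>.\<close>

definition instance_fm :: "'f tm \<Rightarrow> ('f, 'p) fm \<Rightarrow> ('f, 'p) fm" where
  "instance_fm t A = subst_fm (case_nat t Var) A"

lemma fsize_instance_fm [simp]: "fsize (instance_fm t A) = fsize A"
  by (simp add: instance_fm_def)

lemma instance_fm_bind: "instance_fm t (bind x A) = inst t x A"
  unfolding instance_fm_def bind_def inst_def subst_fm_comp
  by (rule subst_fm_cong) auto

text \<open>Lets a derivation whose eigenvariable \<open>x\<close> has been sent to \<open>t\<close>
  serve as the premise for \<open>t\<close> of an infinitary rule: the lifted substitution leaves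
  index 0 alone, and \<open>t\<close> then fills it.\<close>

lemma instance_fm_subst_bind:
  "instance_fm t (subst_fm (lift_subst s) (bind x A)) = subst_fm (s(x := t)) A"
  unfolding instance_fm_def bind_def subst_fm_comp
  by (rule subst_fm_cong) (auto simp: lift_subst_def subst_tm_comp subst_tm_Var)

lemma subst_fm_inst: "subst_fm s (inst t x A) = subst_fm (s(x := subst_tm s t)) A"
  unfolding inst_def subst_fm_comp by (rule subst_fm_cong) auto

lemma wf_tm_subst_tm: "wf_tm F t \<Longrightarrow> \<forall>n. wf_tm F (s n) \<Longrightarrow> wf_tm F (subst_tm s t)"
  by (induction t) (auto simp: list_all_iff)

lemma finite_fv_tm: "finite (fv_tm t)"
  by (induction t) auto

lemma finite_fv: "finite (fv A)"
proof (induction A)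
  case (Forall A)
  then show ?case using finite_vimageI[of "fv A" Suc] by (simp add: vimage_def)
next
  case (Exists A)
  then show ?case using finite_vimageI[of "fv A" Suc] by (simp add: vimage_def)
qed (auto simp: finite_fv_tm)

lemma finite_fv_ctx: "finite (fv_ctx \<Gamma>)"
  by (simp add: fv_ctx_def finite_fv)

lemma fv_ctx_simps [simp]:
  "fv_ctx {#} = {}" "fv_ctx (add_mset A \<Gamma>) = fv A \<union> fv_ctx \<Gamma>"
  "fv_ctx (\<Gamma> + \<Delta>) = fv_ctx \<Gamma> \<union> fv_ctx \<Delta>"
  by (auto simp: fv_ctx_def)

lemma ex_fresh: "finite M \<Longrightarrow> \<exists>x::nat. x \<notin> M"
  by (rule ex_new_if_finite) auto

section \<open>Sequent calculi with infinitary eigenvariable rules\<close>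

text \<open>
  In a pair \<open>(\<Delta>, c)\<close> the context \<open>\<Delta>\<close> replaces the principal formulas of the rule, and
  \<open>c = None\<close> stands for the succedent of the conclusion. The flag selects the left rules for
  implication: those of \<open>\<K>\<close> if it holds, and those of \<open>\<D>\<close> otherwise.
\<close>

inductive left_rule :: "bool \<Rightarrow> ('f \<times> nat) set \<Rightarrow> ('f, 'p) fm multiset \<Rightarrow>
    (('f, 'p) fm multiset \<times> ('f, 'p) fm option) set \<Rightarrow> bool"
  for k :: bool and F :: "('f \<times> nat) set" where
  BotL: "left_rule k F {#Bot#} {}"
| ConjL: "left_rule k F {#A \<^bold>\<and> B#} {({#A, B#}, None)}"
| DisjL: "left_rule k F {#A \<^bold>\<or> B#} {({#A#}, None), ({#B#}, None)}"
| AllL: "wf_tm F t \<Longrightarrow> left_rule k F {#Forall A#} {({#Forall A, instance_fm t A#}, None)}"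
| ExL: "left_rule k F {#Exists A#} {({#instance_fm t A#}, None) |t. wf_tm F t}"
| ImpL: "k \<Longrightarrow> left_rule k F {#A \<^bold>\<Rightarrow> B#} {({#A \<^bold>\<Rightarrow> B#}, Some A), ({#B#}, None)}"
| ImpL_axiom: "\<not> k \<Longrightarrow> left_rule k F {#Atom p ts, Atom p ts \<^bold>\<Rightarrow> B#} {({#Atom p ts, B#}, None)}"
| ImpL_Top: "\<not> k \<Longrightarrow> left_rule k F {#Top \<^bold>\<Rightarrow> B#} {({#B#}, None)}"
| ImpL_Conj: "\<not> k \<Longrightarrow> left_rule k F {#(C \<^bold>\<and> E) \<^bold>\<Rightarrow> B#}
    {({#C \<^bold>\<Rightarrow> B#}, Some C), ({#E \<^bold>\<Rightarrow> B#}, Some E), ({#B#}, None)}"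
| ImpL_Disj1: "\<not> k \<Longrightarrow> left_rule k F {#(C \<^bold>\<or> E) \<^bold>\<Rightarrow> B#}
    {({#C \<^bold>\<Rightarrow> B, E \<^bold>\<Rightarrow> B#}, Some C), ({#B#}, None)}"
| ImpL_Disj2: "\<not> k \<Longrightarrow> left_rule k F {#(C \<^bold>\<or> E) \<^bold>\<Rightarrow> B#}
    {({#C \<^bold>\<Rightarrow> B, E \<^bold>\<Rightarrow> B#}, Some E), ({#B#}, None)}"
| ImpL_Imp: "\<not> k \<Longrightarrow> left_rule k F {#(C \<^bold>\<Rightarrow> E) \<^bold>\<Rightarrow> B#}
    {({#E \<^bold>\<Rightarrow> B, C#}, Some E), ({#B#}, None)}"
| ImpL_All: "\<not> k \<Longrightarrow> left_rule k F {#Forall C \<^bold>\<Rightarrow> B#}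
    (insert ({#B#}, None) {({#Forall C \<^bold>\<Rightarrow> B#}, Some (instance_fm t C)) |t. wf_tm F t})"
| ImpL_Ex: "\<not> k \<Longrightarrow> wf_tm F t \<Longrightarrow> left_rule k F {#Exists C \<^bold>\<Rightarrow> B#}
    {({#Exists C \<^bold>\<Rightarrow> B#}, Some (instance_fm t C)), ({#B#}, None)}"

inductive right_rule :: "('f \<times> nat) set \<Rightarrow> ('f, 'p) fm \<Rightarrow>
    (('f, 'p) fm multiset \<times> ('f, 'p) fm) set \<Rightarrow> bool"
  for F :: "('f \<times> nat) set" where
  TopR: "right_rule F Top {}"
| ConjR: "right_rule F (A \<^bold>\<and> B) {({#}, A), ({#}, B)}"
| DisjR1: "right_rule F (A \<^bold>\<or> B) {({#}, A)}"
| DisjR2: "right_rule F (A \<^bold>\<or> B) {({#}, B)}"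
| ImpR: "right_rule F (A \<^bold>\<Rightarrow> B) {({#A#}, B)}"
| AllR: "right_rule F (Forall A) {({#}, instance_fm t A) |t. wf_tm F t}"
| ExR: "wf_tm F t \<Longrightarrow> right_rule F (Exists A) {({#}, instance_fm t A)}"

text \<open>Rules are kept as data over an arbitrary frame \<Gamma>, so that structural arguments
  have only three cases and serve both calculi.\<close>

inductive deriv :: "bool \<Rightarrow> ('f \<times> nat) set \<Rightarrow> ('f, 'p) fm multiset \<Rightarrow> ('f, 'p) fm \<Rightarrow> bool"
  for k :: bool and F :: "('f \<times> nat) set" where
  axiom: "Atom p ts \<in># \<Gamma> \<Longrightarrow> deriv k F \<Gamma> (Atom p ts)"
| right: "right_rule F G S \<Longrightarrow> (\<And>\<Delta> H. (\<Delta>, H) \<in> S \<Longrightarrow> deriv k F (\<Delta> + \<Gamma>) H) \<Longrightarrow> deriv k F \<Gamma> G"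
| left: "left_rule k F L S \<Longrightarrow>
    (\<And>\<Delta> c. (\<Delta>, c) \<in> S \<Longrightarrow> deriv k F (\<Delta> + \<Gamma>) (case c of None \<Rightarrow> G | Some H \<Rightarrow> H)) \<Longrightarrow>
    deriv k F (L + \<Gamma>) G"

lemma deriv_TopR: "deriv k F \<Gamma> Top"
  by (rule deriv.right[OF TopR]) simp

lemma deriv_ConjR: "deriv k F \<Gamma> A \<Longrightarrow> deriv k F \<Gamma> B \<Longrightarrow> deriv k F \<Gamma> (A \<^bold>\<and> B)"
  by (rule deriv.right[OF ConjR]) auto

lemma deriv_DisjR1: "deriv k F \<Gamma> A \<Longrightarrow> deriv k F \<Gamma> (A \<^bold>\<or> B)"
  by (rule deriv.right[OF DisjR1]) auto

lemma deriv_DisjR2: "deriv k F \<Gamma> B \<Longrightarrow> deriv k F \<Gamma> (A \<^bold>\<or> B)"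
  by (rule deriv.right[OF DisjR2]) auto

lemma deriv_ImpR: "deriv k F (add_mset A \<Gamma>) B \<Longrightarrow> deriv k F \<Gamma> (A \<^bold>\<Rightarrow> B)"
  by (rule deriv.right[OF ImpR]) auto

lemma deriv_AllR: "(\<And>t. wf_tm F t \<Longrightarrow> deriv k F \<Gamma> (instance_fm t A)) \<Longrightarrow> deriv k F \<Gamma> (Forall A)"
  by (rule deriv.right[OF AllR]) auto

lemma deriv_ExR: "deriv k F \<Gamma> (instance_fm t A) \<Longrightarrow> wf_tm F t \<Longrightarrow> deriv k F \<Gamma> (Exists A)"
  by (rule deriv.right[OF ExR]) auto

lemma deriv_left:
  "left_rule k F L S \<Longrightarrow> L + \<Gamma> = \<Gamma>' \<Longrightarrow>
    (\<And>\<Delta> c. (\<Delta>, c) \<in> S \<Longrightarrow> deriv k F (\<Delta> + \<Gamma>) (case c of None \<Rightarrow> G | Some H \<Rightarrow> H)) \<Longrightarrow>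
    deriv k F \<Gamma>' G"
  using deriv.left by blast

lemma deriv_BotL: "deriv k F (add_mset Bot \<Gamma>) G"
  by (rule deriv_left[OF BotL, of \<Gamma>]) auto

lemma deriv_ConjL: "deriv k F (add_mset A (add_mset B \<Gamma>)) G \<Longrightarrow> deriv k F (add_mset (A \<^bold>\<and> B) \<Gamma>) G"
  by (rule deriv_left[OF ConjL, of _ _ \<Gamma>]) auto

lemma deriv_DisjL: "deriv k F (add_mset A \<Gamma>) G \<Longrightarrow> deriv k F (add_mset B \<Gamma>) G \<Longrightarrow>
    deriv k F (add_mset (A \<^bold>\<or> B) \<Gamma>) G"
  by (rule deriv_left[OF DisjL, of _ _ \<Gamma>]) auto

lemma deriv_AllL: "deriv k F (add_mset (Forall A) (add_mset (instance_fm t A) \<Gamma>)) G \<Longrightarrow> wf_tm F t \<Longrightarrow>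
    deriv k F (add_mset (Forall A) \<Gamma>) G"
  by (rule deriv_left[OF AllL, of _ t _ \<Gamma>]) auto

lemma deriv_ExL: "(\<And>t. wf_tm F t \<Longrightarrow> deriv k F (add_mset (instance_fm t A) \<Gamma>) G) \<Longrightarrow>
    deriv k F (add_mset (Exists A) \<Gamma>) G"
  by (rule deriv_left[OF ExL, of _ \<Gamma>]) auto

lemma deriv_ImpL: "deriv True F (add_mset (A \<^bold>\<Rightarrow> B) \<Gamma>) A \<Longrightarrow> deriv True F (add_mset B \<Gamma>) G \<Longrightarrow>
    deriv True F (add_mset (A \<^bold>\<Rightarrow> B) \<Gamma>) G"
  by (rule deriv_left[OF ImpL, of _ _ _ \<Gamma>]) auto

lemma deriv_ImpL_axiom: "deriv False F (add_mset (Atom p ts) (add_mset B \<Gamma>)) G \<Longrightarrow>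
    deriv False F (add_mset (Atom p ts) (add_mset (Atom p ts \<^bold>\<Rightarrow> B) \<Gamma>)) G"
  by (rule deriv_left[OF ImpL_axiom, of _ p ts B \<Gamma>]) auto

lemma deriv_ImpL_Top: "deriv False F (add_mset B \<Gamma>) G \<Longrightarrow> deriv False F (add_mset (Top \<^bold>\<Rightarrow> B) \<Gamma>) G"
  by (rule deriv_left[OF ImpL_Top, of _ _ \<Gamma>]) auto

lemma deriv_ImpL_Conj: "deriv False F (add_mset (C \<^bold>\<Rightarrow> B) \<Gamma>) C \<Longrightarrow>
    deriv False F (add_mset (E \<^bold>\<Rightarrow> B) \<Gamma>) E \<Longrightarrow> deriv False F (add_mset B \<Gamma>) G \<Longrightarrow>
    deriv False F (add_mset ((C \<^bold>\<and> E) \<^bold>\<Rightarrow> B) \<Gamma>) G"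
  by (rule deriv_left[OF ImpL_Conj, of _ C E B \<Gamma>]) auto

lemma deriv_ImpL_Disj1: "deriv False F (add_mset (C \<^bold>\<Rightarrow> B) (add_mset (E \<^bold>\<Rightarrow> B) \<Gamma>)) C \<Longrightarrow>
    deriv False F (add_mset B \<Gamma>) G \<Longrightarrow> deriv False F (add_mset ((C \<^bold>\<or> E) \<^bold>\<Rightarrow> B) \<Gamma>) G"
  by (rule deriv_left[OF ImpL_Disj1, of _ C E B \<Gamma>]) auto

lemma deriv_ImpL_Disj2: "deriv False F (add_mset (C \<^bold>\<Rightarrow> B) (add_mset (E \<^bold>\<Rightarrow> B) \<Gamma>)) E \<Longrightarrow>
    deriv False F (add_mset B \<Gamma>) G \<Longrightarrow> deriv False F (add_mset ((C \<^bold>\<or> E) \<^bold>\<Rightarrow> B) \<Gamma>) G"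
  by (rule deriv_left[OF ImpL_Disj2, of _ C E B \<Gamma>]) auto

lemma deriv_ImpL_Imp: "deriv False F (add_mset (E \<^bold>\<Rightarrow> B) (add_mset C \<Gamma>)) E \<Longrightarrow>
    deriv False F (add_mset B \<Gamma>) G \<Longrightarrow> deriv False F (add_mset ((C \<^bold>\<Rightarrow> E) \<^bold>\<Rightarrow> B) \<Gamma>) G"
  by (rule deriv_left[OF ImpL_Imp, of _ C E B \<Gamma>]) auto

lemma deriv_ImpL_All:
  "(\<And>t. wf_tm F t \<Longrightarrow> deriv False F (add_mset (Forall C \<^bold>\<Rightarrow> B) \<Gamma>) (instance_fm t C)) \<Longrightarrow>
    deriv False F (add_mset B \<Gamma>) G \<Longrightarrow> deriv False F (add_mset (Forall C \<^bold>\<Rightarrow> B) \<Gamma>) G"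
  by (rule deriv_left[OF ImpL_All, of _ C B \<Gamma>]) auto

lemma deriv_ImpL_Ex: "deriv False F (add_mset (Exists C \<^bold>\<Rightarrow> B) \<Gamma>) (instance_fm t C) \<Longrightarrow> wf_tm F t \<Longrightarrow>
    deriv False F (add_mset B \<Gamma>) G \<Longrightarrow> deriv False F (add_mset (Exists C \<^bold>\<Rightarrow> B) \<Gamma>) G"
  by (rule deriv_left[OF ImpL_Ex, of _ _ t C B \<Gamma>]) auto

section \<open>Weakening, replacement of hypotheses, and inversion\<close>

lemma weakening: "deriv k F \<Gamma> G \<Longrightarrow> deriv k F (\<Gamma> + \<Theta>) G"
proof (induction rule: deriv.induct)
  case (axiom p ts \<Gamma>)
  then show ?case by (intro deriv.axiom) auto
next
  case (right G S \<Gamma>)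
  show ?case
    by (rule deriv.right[OF right.hyps(1)]) (use right.IH in \<open>simp add: add.assoc\<close>)
next
  case (left L S \<Gamma> G)
  show ?case unfolding add.assoc
    by (rule deriv.left[OF left.hyps(1)]) (use left.IH in \<open>simp add: add.assoc\<close>)
qed

lemma weakening_mono: "deriv k F \<Gamma> G \<Longrightarrow> \<Gamma> \<subseteq># \<Delta> \<Longrightarrow> deriv k F \<Delta> G"
  using weakening by (metis subset_mset.add_diff_inverse)

lemma non_principal:
  assumes "L + \<Gamma>' = add_mset X \<Gamma>" "X \<notin># L"
  obtains \<Gamma>1 where "\<Gamma>' = add_mset X \<Gamma>1" "\<Gamma> = L + \<Gamma>1"
proof -
  have "X \<in># \<Gamma>'" using assms by (metis union_iff union_single_eq_member)
  then obtain \<Gamma>1 where "\<Gamma>' = add_mset X \<Gamma>1" by (metis insert_DiffM)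
  then show thesis using assms that by simp
qed

text \<open>One induction serves both inversion and the replacement of implications. As long as
  \<open>X\<close> is not principal it is replaced in all premises; where it is principal the
  induction stops and \<open>principal\<close> takes over with the unmodified premises. Axioms
  survive because \<open>X\<close> is not atomic.\<close>

lemma deriv_replace:
  assumes "deriv k F (add_mset X \<Gamma>) G" and "\<And>p ts. X \<noteq> Atom p ts"
    and principal: "\<And>L S \<Gamma> G. left_rule k F L S \<Longrightarrow> X \<in># L \<Longrightarrow>
      (\<And>\<Delta> c. (\<Delta>, c) \<in> S \<Longrightarrow> deriv k F (\<Delta> + \<Gamma>) (case c of None \<Rightarrow> G | Some H \<Rightarrow> H)) \<Longrightarrow>
      deriv k F (L - {#X#} + \<Theta> + \<Gamma>) G"
  shows "deriv k F (\<Theta> + \<Gamma>) G"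
  using assms(1)
proof (induction "add_mset X \<Gamma>" G arbitrary: \<Gamma> rule: deriv.induct)
  case (axiom p ts)
  then show ?case using assms(2) by (intro deriv.axiom) auto
next
  case (right G S)
  have "deriv k F (\<Delta> + (\<Theta> + \<Gamma>)) H" if "(\<Delta>, H) \<in> S" for \<Delta> H
    using right.hyps(3)[OF that, of "\<Delta> + \<Gamma>"] by (simp add: ac_simps)
  then show ?case by (rule deriv.right[OF right.hyps(1)])
next
  case (left L S \<Gamma>' G)
  show ?case
  proof (cases "X \<in># L")
    case True
    then have "\<Gamma> = L - {#X#} + \<Gamma>'" using left.hyps(4)
      by (metis add_mset_remove_trivial diff_union_single_conv union_commute)
    then show ?thesis using principal[OF left.hyps(1) True left.hyps(2)] by (simp add: ac_simps)
  next
    case False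
    with left.hyps(4) obtain \<Gamma>1 where "\<Gamma>' = add_mset X \<Gamma>1" and eq: "\<Gamma> = L + \<Gamma>1"
      by (rule non_principal)
    then have "deriv k F (\<Delta> + (\<Theta> + \<Gamma>1)) (case c of None \<Rightarrow> G | Some H \<Rightarrow> H)"
      if "(\<Delta>, c) \<in> S" for \<Delta> c
      using left.hyps(3)[OF that, of "\<Delta> + \<Gamma>1"] by (simp add: ac_simps)
    from deriv.left[OF left.hyps(1) this] show ?thesis using eq by (simp add: ac_simps)
  qed
qed

text \<open>Here each rule with \<open>X\<close> principal already has a premise with \<Theta> in
  place of \<open>X\<close> and the same goal, and that premise is the result.\<close>

lemma deriv_invert:
  assumes "deriv k F (add_mset X \<Gamma>) G" "\<And>p ts. X \<noteq> Atom p ts"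
    and "\<And>L S. left_rule k F L S \<Longrightarrow> X \<in># L \<Longrightarrow> (L - {#X#} + \<Theta>, None) \<in> S"
  shows "deriv k F (\<Theta> + \<Gamma>) G"
  using assms(1,2)
proof (rule deriv_replace)
  fix L S \<Gamma> and G :: "('a, 'b) fm"
  assume "left_rule k F L S" "X \<in># L" and
    *: "\<And>\<Delta> c. (\<Delta>, c) \<in> S \<Longrightarrow> deriv k F (\<Delta> + \<Gamma>) (case c of None \<Rightarrow> G | Some H \<Rightarrow> H)"
  then show "deriv k F (L - {#X#} + \<Theta> + \<Gamma>) G" using *[OF assms(3)] by simp
qed

lemma ConjL_inv: "deriv k F (add_mset (A \<^bold>\<and> B) \<Gamma>) G \<Longrightarrow> deriv k F ({#A, B#} + \<Gamma>) G"
  by (erule deriv_invert) (auto elim!: left_rule.cases)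

lemma DisjL_inv:
  assumes "deriv k F (add_mset (A \<^bold>\<or> B) \<Gamma>) G"
  shows "deriv k F ({#A#} + \<Gamma>) G" "deriv k F ({#B#} + \<Gamma>) G"
  by (rule deriv_invert[OF assms]; auto elim!: left_rule.cases)+

lemma ExL_inv:
  "deriv k F (add_mset (Exists A) \<Gamma>) G \<Longrightarrow> wf_tm F t \<Longrightarrow> deriv k F ({#instance_fm t A#} + \<Gamma>) G"
  by (erule deriv_invert) (auto elim!: left_rule.cases)

lemma ImpL_inv: "deriv k F (add_mset (A \<^bold>\<Rightarrow> B) \<Gamma>) G \<Longrightarrow> deriv k F ({#B#} + \<Gamma>) G"
  by (erule deriv_invert) (auto elim!: left_rule.cases)

text \<open>For \<open>AllL\<close> the premise only extends the conclusion. In all other rules it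
  arises by inverting the non-atomic principal formula; for an implication this puts
  \<open>B\<close> in place of \<open>A \<Rightarrow> B\<close>, whatever \<open>A\<close>
  is.\<close>

lemma left_rule_inv:
  assumes "left_rule k F L S" "(\<Delta>, None) \<in> S" "deriv k F (L + \<Gamma>) G"
  shows "deriv k F (\<Delta> + \<Gamma>) G"
  using assms
proof (cases rule: left_rule.cases)
  case (AllL t A)
  then show ?thesis using assms by (auto intro: weakening_mono)
next
  case (ImpL_axiom p ts B)
  then show ?thesis using assms ImpL_inv[of k F "Atom p ts" B "add_mset (Atom p ts) \<Gamma>" G]
    by (auto simp: add_mset_commute)
qed (use assms in \<open>auto dest: ConjL_inv DisjL_inv ExL_inv ImpL_inv\<close>)

section \<open>Contraction\<close>

definition contractible :: "bool \<Rightarrow> ('f \<times> nat) set \<Rightarrow> ('f, 'p) fm \<Rightarrow> bool" where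
  "contractible k F A \<longleftrightarrow>
    (\<forall>\<Gamma> G. deriv k F (add_mset A (add_mset A \<Gamma>)) G \<longrightarrow> deriv k F (add_mset A \<Gamma>) G)"

definition imp_left_admissible :: "bool \<Rightarrow> ('f \<times> nat) set \<Rightarrow> ('f, 'p) fm \<Rightarrow> bool" where
  "imp_left_admissible k F A \<longleftrightarrow>
    (\<forall>\<Gamma> B G. deriv k F (add_mset (A \<^bold>\<Rightarrow> B) \<Gamma>) A \<longrightarrow> deriv k F (add_mset B \<Gamma>) G \<longrightarrow>
      deriv k F (add_mset (A \<^bold>\<Rightarrow> B) \<Gamma>) G)"

lemma contract_mset:
  assumes "\<And>A. A \<in># \<Delta> \<Longrightarrow> contractible k F A" "deriv k F (\<Delta> + \<Delta> + \<Gamma>) G"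
  shows "deriv k F (\<Delta> + \<Gamma>) G"
  using assms
proof (induction \<Delta> arbitrary: \<Gamma>)
  case (add A \<Delta>)
  have "deriv k F (\<Delta> + \<Delta> + add_mset A \<Gamma>) G"
    using add.prems by (auto simp: contractible_def)
  then show ?case using add.IH[of "add_mset A \<Gamma>"] add.prems(1) by simp
qed simp

lemma imp_left_admissibleD:
  "imp_left_admissible k F A \<Longrightarrow> deriv k F (add_mset (A \<^bold>\<Rightarrow> B) \<Gamma>) A \<Longrightarrow> deriv k F (add_mset B \<Gamma>) G \<Longrightarrow>
    deriv k F (add_mset (A \<^bold>\<Rightarrow> B) \<Gamma>) G"
  by (simp add: imp_left_admissible_def)

text \<open>The implication is traced up to the rule that has it as principal formula. That rule
  provides \<open>C \<Rightarrow> B\<close> with goal \<open>C\<close>, and \<open>B\<close> with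
  goal \<open>G\<close>; admissibility for the smaller antecedent \<open>C\<close> combines them.
  The same works for \<open>E\<close>, and the next two lemmas follow this pattern.\<close>

lemma ImpL_Conj_replace:
  assumes "deriv False F (add_mset ((C \<^bold>\<and> E) \<^bold>\<Rightarrow> B) \<Gamma>) G"
    and "imp_left_admissible False F C" "imp_left_admissible False F E"
  shows "deriv False F ({#C \<^bold>\<Rightarrow> B#} + \<Gamma>) G" "deriv False F ({#E \<^bold>\<Rightarrow> B#} + \<Gamma>) G"
proof -
  have "deriv False F (L - {#(C \<^bold>\<and> E) \<^bold>\<Rightarrow> B#} + {#C \<^bold>\<Rightarrow> B#} + \<Gamma>) G \<and>
      deriv False F (L - {#(C \<^bold>\<and> E) \<^bold>\<Rightarrow> B#} + {#E \<^bold>\<Rightarrow> B#} + \<Gamma>) G"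
    if "left_rule False F L S" "((C \<^bold>\<and> E) \<^bold>\<Rightarrow> B) \<in># L" and
    *: "\<And>\<Delta> c. (\<Delta>, c) \<in> S \<Longrightarrow> deriv False F (\<Delta> + \<Gamma>) (case c of None \<Rightarrow> G | Some H \<Rightarrow> H)"
    for L S \<Gamma> and G :: "('a, 'b) fm"
  proof -
    have S: "L = {#(C \<^bold>\<and> E) \<^bold>\<Rightarrow> B#}" "({#C \<^bold>\<Rightarrow> B#}, Some C) \<in> S" "({#E \<^bold>\<Rightarrow> B#}, Some E) \<in> S"
      "({#B#}, None) \<in> S"
      using that(1,2) by (auto elim!: left_rule.cases)
    then show ?thesis
      using *[OF S(2)] *[OF S(3)] *[OF S(4)] assms(2,3) by (simp add: imp_left_admissibleD)
  qed
  note * = this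
  show "deriv False F ({#C \<^bold>\<Rightarrow> B#} + \<Gamma>) G"
    by (rule deriv_replace[OF assms(1)]) (simp, rule *[THEN conjunct1])
  show "deriv False F ({#E \<^bold>\<Rightarrow> B#} + \<Gamma>) G"
    by (rule deriv_replace[OF assms(1)]) (simp, rule *[THEN conjunct2])
qed

lemma ImpL_Disj_replace:
  assumes "deriv False F (add_mset ((C \<^bold>\<or> E) \<^bold>\<Rightarrow> B) \<Gamma>) G"
    and "imp_left_admissible False F C" "imp_left_admissible False F E"
  shows "deriv False F ({#C \<^bold>\<Rightarrow> B, E \<^bold>\<Rightarrow> B#} + \<Gamma>) G"
proof (rule deriv_replace[OF assms(1)])
  fix L S \<Gamma> and G :: "('a, 'b) fm"
  assume rule: "left_rule False F L S" "((C \<^bold>\<or> E) \<^bold>\<Rightarrow> B) \<in># L" and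
    *: "\<And>\<Delta> c. (\<Delta>, c) \<in> S \<Longrightarrow> deriv False F (\<Delta> + \<Gamma>) (case c of None \<Rightarrow> G | Some H \<Rightarrow> H)"
  from rule consider "L = {#(C \<^bold>\<or> E) \<^bold>\<Rightarrow> B#}" "({#C \<^bold>\<Rightarrow> B, E \<^bold>\<Rightarrow> B#}, Some C) \<in> S" "({#B#}, None) \<in> S"
    | "L = {#(C \<^bold>\<or> E) \<^bold>\<Rightarrow> B#}" "({#C \<^bold>\<Rightarrow> B, E \<^bold>\<Rightarrow> B#}, Some E) \<in> S" "({#B#}, None) \<in> S"
    by (auto elim!: left_rule.cases)
  then show "deriv False F (L - {#(C \<^bold>\<or> E) \<^bold>\<Rightarrow> B#} + {#C \<^bold>\<Rightarrow> B, E \<^bold>\<Rightarrow> B#} + \<Gamma>) G"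
  proof cases
    case 1
    have "deriv False F (add_mset B (add_mset (E \<^bold>\<Rightarrow> B) \<Gamma>)) G"
      using *[OF 1(3)] by (auto intro: weakening_mono)
    then show ?thesis using *[OF 1(2)] 1(1) assms(2) by (simp add: imp_left_admissibleD)
  next
    case 2
    have "deriv False F (add_mset B (add_mset (C \<^bold>\<Rightarrow> B) \<Gamma>)) G"
      using *[OF 2(3)] by (auto intro: weakening_mono)
    then show ?thesis
      using *[OF 2(2)] 2(1) imp_left_admissibleD[OF assms(3), of B "add_mset (C \<^bold>\<Rightarrow> B) \<Gamma>" G]
      by (simp add: add_mset_commute)
  qed
qed simp

lemma ImpL_Imp_replace:
  assumes "deriv False F (add_mset ((C \<^bold>\<Rightarrow> E) \<^bold>\<Rightarrow> B) \<Gamma>) G" and "imp_left_admissible False F E"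
  shows "deriv False F ({#E \<^bold>\<Rightarrow> B, C#} + \<Gamma>) G"
proof (rule deriv_replace[OF assms(1)])
  fix L S \<Gamma> and G :: "('a, 'b) fm"
  assume rule: "left_rule False F L S" "((C \<^bold>\<Rightarrow> E) \<^bold>\<Rightarrow> B) \<in># L" and
    *: "\<And>\<Delta> c. (\<Delta>, c) \<in> S \<Longrightarrow> deriv False F (\<Delta> + \<Gamma>) (case c of None \<Rightarrow> G | Some H \<Rightarrow> H)"
  from rule have S: "L = {#(C \<^bold>\<Rightarrow> E) \<^bold>\<Rightarrow> B#}" "({#E \<^bold>\<Rightarrow> B, C#}, Some E) \<in> S" "({#B#}, None) \<in> S"
    by (auto elim!: left_rule.cases)
  have "deriv False F (add_mset B (add_mset C \<Gamma>)) G"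
    using *[OF S(3)] by (auto intro: weakening_mono)
  then show "deriv False F (L - {#(C \<^bold>\<Rightarrow> E) \<^bold>\<Rightarrow> B#} + {#E \<^bold>\<Rightarrow> B, C#} + \<Gamma>) G"
    using *[OF S(2)] S(1) assms(2) by (simp add: imp_left_admissibleD)
qed simp

text \<open>Serves contraction: once a rule has decomposed one copy of \<open>X\<close>, the other
  copy has to be decomposed in the same way inside the premise. Inversion does this for premises
  with the old goal, and the replacement lemmas do it for the premises of \<D> that change the
  goal.\<close>

lemma premise_replace:
  fixes X :: "('f, 'p) fm"
  assumes "left_rule k F L S" "X \<in># L" "(\<Delta>, c) \<in> S" "X \<notin># \<Delta>"
    and adm: "\<And>Y :: ('f, 'p) fm. \<not> k \<Longrightarrow> fsize Y < fsize X \<Longrightarrow> imp_left_admissible k F Y"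
    and "deriv k F (add_mset X \<Gamma>) G"
  shows "deriv k F (\<Delta> + \<Gamma>) G"
  using assms(1)
proof (cases rule: left_rule.cases)
  case (ImpL_axiom p ts B)
  \<comment> \<open>The atom of this rule stays in its premise, so only the implication can be the
    formula that disappears.\<close>
  then have "X = Atom p ts \<^bold>\<Rightarrow> B" "\<Delta> = {#Atom p ts, B#}" using assms(2-4) by auto
  then show ?thesis using ImpL_inv[of k F "Atom p ts" B \<Gamma> G] assms(6) by (auto intro: weakening_mono)
next
  case (ImpL_Conj C E B)
  then have "imp_left_admissible False F C" "imp_left_admissible False F E" using adm assms(2) by simp_all
  then show ?thesis using ImpL_Conj assms(2,3,6) ImpL_Conj_replace[of F C E B \<Gamma> G]
    by (auto dest: ImpL_inv)
next
  case (ImpL_Disj1 C E B)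
  then have "imp_left_admissible False F C" "imp_left_admissible False F E" using adm assms(2) by simp_all
  then show ?thesis using ImpL_Disj1 assms(2,3,6) ImpL_Disj_replace[of F C E B \<Gamma> G]
    by (auto dest: ImpL_inv)
next
  case (ImpL_Disj2 C E B)
  then have "imp_left_admissible False F C" "imp_left_admissible False F E" using adm assms(2) by simp_all
  then show ?thesis using ImpL_Disj2 assms(2,3,6) ImpL_Disj_replace[of F C E B \<Gamma> G]
    by (auto dest: ImpL_inv)
next
  case (ImpL_Imp C E B)
  then have "imp_left_admissible False F E" using adm assms(2) by simp_all
  then show ?thesis using ImpL_Imp assms(2,3,6) ImpL_Imp_replace[of F C E B \<Gamma> G]
    by (auto dest: ImpL_inv)
qed (use assms(2-4,6) in \<open>auto dest: ConjL_inv DisjL_inv ExL_inv ImpL_inv\<close>)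

text \<open>The implication rules of \<D> shrink the antecedent, so a rule that does not keep
  \<open>X\<close> leaves only smaller formulas to contract.\<close>

lemma premise_smaller:
  "left_rule k F L S \<Longrightarrow> X \<in># L \<Longrightarrow> (\<Delta>, c) \<in> S \<Longrightarrow> X \<notin># \<Delta> \<Longrightarrow> Y \<in># \<Delta> \<Longrightarrow> fsize Y < fsize X"
  by (erule left_rule.cases) auto

text \<open>Only \<open>ImpL_axiom\<close> has two principal formulas, an atom and an implication,
  and these differ. The second copy of \<open>X\<close> in a contraction therefore lies in the
  frame.\<close>

lemma principal_once: "left_rule k F L S \<Longrightarrow> X \<notin># L - {#X#}"
  by (induction rule: left_rule.induct) (auto simp: in_diff_count split: if_splits)

lemma contractible_step:
  fixes X :: "('f, 'p) fm"
  assumes contr: "\<And>Y :: ('f, 'p) fm. fsize Y < fsize X \<Longrightarrow> contractible k F Y"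
    and adm: "\<And>Y :: ('f, 'p) fm. \<not> k \<Longrightarrow> fsize Y < fsize X \<Longrightarrow> imp_left_admissible k F Y"
  shows "contractible k F X"
proof -
  have "deriv k F (add_mset X \<Gamma>) G" if "deriv k F (add_mset X (add_mset X \<Gamma>)) G" for \<Gamma> G
    using that
  proof (induction "add_mset X (add_mset X \<Gamma>)" G arbitrary: \<Gamma> rule: deriv.induct)
    case (axiom p ts)
    then show ?case by (intro deriv.axiom) auto
  next
    case (right G S)
    have "deriv k F (\<Delta> + add_mset X \<Gamma>) H" if "(\<Delta>, H) \<in> S" for \<Delta> H
      using right.hyps(3)[OF that, of "\<Delta> + \<Gamma>"] by simp
    then show ?case by (rule deriv.right[OF right.hyps(1)])
  next
    case (left L S \<Gamma>' G)
    show ?case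
    proof (cases "X \<in># L")
      case False
      with left.hyps(4) obtain \<Gamma>1 where \<Gamma>1: "\<Gamma>' = add_mset X \<Gamma>1" "add_mset X \<Gamma> = L + \<Gamma>1"
        by (rule non_principal)
      from \<Gamma>1(2)[symmetric] False obtain \<Gamma>2 where \<Gamma>2: "\<Gamma>1 = add_mset X \<Gamma>2" "\<Gamma> = L + \<Gamma>2"
        by (rule non_principal)
      have "deriv k F (\<Delta> + add_mset X \<Gamma>2) (case c of None \<Rightarrow> G | Some H \<Rightarrow> H)"
        if "(\<Delta>, c) \<in> S" for \<Delta> c
        using left.hyps(3)[OF that, of "\<Delta> + \<Gamma>2"] \<Gamma>1 \<Gamma>2 by simp
      from deriv.left[OF left.hyps(1) this] show ?thesis using \<Gamma>2 by simp
    next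
      case True
      \<comment> \<open>\<open>M\<close> is nonempty only for \<open>ImpL_axiom\<close>, where it
        holds the other principal formula.\<close>
      define M where "M = L - {#X#}"
      have L: "L = add_mset X M" using True by (simp add: M_def)
      have "X \<notin># M" using principal_once[OF left.hyps(1)] by (simp add: M_def)
      moreover have "M + \<Gamma>' = add_mset X \<Gamma>" using left.hyps(4) L by simp
      ultimately obtain \<Gamma>1 where \<Gamma>1: "\<Gamma>' = add_mset X \<Gamma>1" "\<Gamma> = M + \<Gamma>1"
        by (metis non_principal)
      have "deriv k F (\<Delta> + \<Gamma>1) (case c of None \<Rightarrow> G | Some H \<Rightarrow> H)"
        if S: "(\<Delta>, c) \<in> S" for \<Delta> c
      proof (cases "X \<in># \<Delta>")
        case True
        then obtain \<Delta>' where "\<Delta> = add_mset X \<Delta>'" by (metis insert_DiffM)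
        then show ?thesis using left.hyps(3)[OF S, of "\<Delta>' + \<Gamma>1"] \<Gamma>1 by simp
      next
        case False
        \<comment> \<open>The premise has lost one copy of \<open>X\<close>. Decomposing the
          remaining copy in the same way gives \<Delta> twice, and its formulas are small enough to
          contract.\<close>
        have "deriv k F (add_mset X (\<Delta> + \<Gamma>1)) (case c of None \<Rightarrow> G | Some H \<Rightarrow> H)"
          using left.hyps(2)[OF S] \<Gamma>1 by simp
        then have "deriv k F (\<Delta> + \<Delta> + \<Gamma>1) (case c of None \<Rightarrow> G | Some H \<Rightarrow> H)"
          using premise_replace[OF left.hyps(1) True S False adm] by (simp add: add.assoc)
        then show ?thesis
          by (rule contract_mset[rotated]) (rule contr[OF premise_smaller[OF left.hyps(1) True S False]])
      qed
      from deriv.left[OF left.hyps(1) this] show ?thesis using \<Gamma>1 L by simp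
    qed
  qed
  then show ?thesis by (simp add: contractible_def)
qed

text \<open>In \<K> the premise of an implication rule that changes the goal keeps the implication,
  so induction on size closes with no appeal to admissibility.\<close>

lemma contractible_True: "contractible True F X"
proof (induction X rule: measure_induct_rule[of fsize])
  case (less X)
  show ?case by (rule contractible_step) (simp_all add: less)
qed

section \<open>Admissibility of the left implication rule of \<open>\<K>\<close> in \<open>\<D>\<close>\<close>

text \<open>When \<open>A \<Rightarrow> B\<close> is itself principal on the path being followed,
  this identifies the premise with the old goal as the given derivation from
  \<open>B\<close>.\<close>

lemma imp_side_premise:
  "left_rule False F L S \<Longrightarrow> (A \<^bold>\<Rightarrow> B) \<in># L \<Longrightarrow> (\<Delta>, None) \<in> S \<Longrightarrow> \<Delta> = add_mset B (L - {#A \<^bold>\<Rightarrow> B#})"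
  by (erule left_rule.cases) auto

lemma imp_left_admissible_right:
  fixes A :: "('f, 'p) fm"
  assumes contr: "\<And>Y :: ('f, 'p) fm. fsize Y < fsize A \<Longrightarrow> contractible False F Y"
    and adm: "\<And>Y :: ('f, 'p) fm. fsize Y < fsize A \<Longrightarrow> imp_left_admissible False F Y"
    and rr: "right_rule F A S"
    and prem: "\<And>\<Delta> H. (\<Delta>, H) \<in> S \<Longrightarrow> deriv False F (\<Delta> + add_mset (A \<^bold>\<Rightarrow> B) \<Gamma>) H"
    and B: "deriv False F (add_mset B \<Gamma>) G"
  shows "deriv False F (add_mset (A \<^bold>\<Rightarrow> B) \<Gamma>) G"
  using rr
proof (cases rule: right_rule.cases)
  case TopR
  then show ?thesis using B by (simp add: deriv_ImpL_Top)
next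
  case (ConjR C E)
  have "deriv False F ({#C \<^bold>\<Rightarrow> B#} + \<Gamma>) C" "deriv False F ({#E \<^bold>\<Rightarrow> B#} + \<Gamma>) E"
    using ImpL_Conj_replace(1)[of F C E B \<Gamma> C] ImpL_Conj_replace(2)[of F C E B \<Gamma> E]
      prem[of "{#}" C] prem[of "{#}" E] adm[of C] adm[of E] ConjR by simp_all
  then show ?thesis using B ConjR by (simp add: deriv_ImpL_Conj)
next
  case (DisjR1 C E)
  have "deriv False F ({#C \<^bold>\<Rightarrow> B, E \<^bold>\<Rightarrow> B#} + \<Gamma>) C"
    using ImpL_Disj_replace[of F C E B \<Gamma> C] prem[of "{#}" C] adm[of C] adm[of E] DisjR1 by simp
  then show ?thesis using B DisjR1 by (simp add: deriv_ImpL_Disj1)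
next
  case (DisjR2 C E)
  have "deriv False F ({#C \<^bold>\<Rightarrow> B, E \<^bold>\<Rightarrow> B#} + \<Gamma>) E"
    using ImpL_Disj_replace[of F C E B \<Gamma> E] prem[of "{#}" E] adm[of C] adm[of E] DisjR2 by simp
  then show ?thesis using B DisjR2 by (simp add: deriv_ImpL_Disj2)
next
  case (ImpR C E)
  have "deriv False F (add_mset ((C \<^bold>\<Rightarrow> E) \<^bold>\<Rightarrow> B) (add_mset C \<Gamma>)) E"
    using prem[of "{#C#}" E] ImpR by (simp add: add_mset_commute)
  then have "deriv False F ({#E \<^bold>\<Rightarrow> B, C#} + add_mset C \<Gamma>) E"
    by (rule ImpL_Imp_replace) (use adm ImpR in simp)
  \<comment> \<open>One \<open>C\<close> comes from the right rule and one from the replacement,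
    while the left rule of \<D> allows a single \<open>C\<close>; hence the contraction.\<close>
  then have "deriv False F ({#C#} + {#C#} + add_mset (E \<^bold>\<Rightarrow> B) \<Gamma>) E"
    by (simp add: add_mset_commute)
  then have "deriv False F ({#C#} + add_mset (E \<^bold>\<Rightarrow> B) \<Gamma>) E"
    by (rule contract_mset[rotated]) (use contr ImpR in simp)
  then have "deriv False F (add_mset (E \<^bold>\<Rightarrow> B) (add_mset C \<Gamma>)) E"
    by (simp add: add_mset_commute)
  then show ?thesis using B ImpR by (simp add: deriv_ImpL_Imp)
next
  case (AllR C)
  \<comment> \<open>The rules of \<D> for quantified antecedents keep the implication, so the
    premises of the right rule fit as they stand.\<close>
  have "deriv False F (add_mset (Forall C \<^bold>\<Rightarrow> B) \<Gamma>) (instance_fm t C)" if "wf_tm F t" for t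
    using prem[of "{#}" "instance_fm t C"] AllR that by auto
  then show ?thesis using B AllR by (simp add: deriv_ImpL_All)
next
  case (ExR t C)
  then show ?thesis using B prem[of "{#}" "instance_fm t C"] deriv_ImpL_Ex[of F C B \<Gamma> t G] by simp
qed

lemma imp_left_admissible_step:
  fixes A :: "('f, 'p) fm"
  assumes contr: "\<And>Y :: ('f, 'p) fm. fsize Y < fsize A \<Longrightarrow> contractible False F Y"
    and adm: "\<And>Y :: ('f, 'p) fm. fsize Y < fsize A \<Longrightarrow> imp_left_admissible False F Y"
  shows "imp_left_admissible False F A"
proof -
  \<comment> \<open>The induction follows only premises that inherit the goal \<open>A\<close>. Goal
    and context are therefore variables tied by equations, and \<open>G\<close> is the goal that
    replaces \<open>A\<close>.\<close>
  have "deriv False F (add_mset (A \<^bold>\<Rightarrow> B) \<Gamma>) G"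
    if "deriv False F \<Xi> H" "H = A" "\<Xi> = add_mset (A \<^bold>\<Rightarrow> B) \<Gamma>" "deriv False F (add_mset B \<Gamma>) G"
    for B \<Gamma> G \<Xi> H
    using that
  proof (induction arbitrary: \<Gamma> rule: deriv.induct)
    case (axiom p ts \<Xi>)
    then have "Atom p ts \<in># \<Gamma>" by auto
    then obtain \<Gamma>1 where "\<Gamma> = add_mset (Atom p ts) \<Gamma>1" by (metis insert_DiffM)
    then show ?case using axiom deriv_ImpL_axiom[of F p ts B \<Gamma>1 G] by (simp add: add_mset_commute)
  next
    case (right H S \<Xi>)
    show ?case
    proof (rule imp_left_admissible_right)
      show "right_rule F A S" using right.hyps(1) right.prems(1) by simp
      show "deriv False F (\<Delta> + add_mset (A \<^bold>\<Rightarrow> B) \<Gamma>) K" if "(\<Delta>, K) \<in> S" for \<Delta> K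
        using right.hyps(2)[OF that] right.prems(2) by simp
    qed (use contr adm right.prems(3) in auto)
  next
    case (left L S \<Gamma>' H)
    show ?case
    proof (cases "(A \<^bold>\<Rightarrow> B) \<in># L")
      case True
      define M where "M = L - {#A \<^bold>\<Rightarrow> B#}"
      have L: "L = add_mset (A \<^bold>\<Rightarrow> B) M" using True by (simp add: M_def)
      have \<Gamma>: "\<Gamma> = M + \<Gamma>'" using left.prems(2) L by simp
      \<comment> \<open>The same rule is applied again with goal \<open>G\<close>: its
        \<open>None\<close> premise is the given derivation from \<open>B\<close>, and its other
        premises do not depend on the goal.\<close>
      have "deriv False F (\<Delta> + \<Gamma>') (case c of None \<Rightarrow> G | Some H \<Rightarrow> H)" if S: "(\<Delta>, c) \<in> S" for \<Delta> c
      proof (cases c)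
        case None
        then have "\<Delta> = add_mset B M" using imp_side_premise[OF left.hyps(1) True] S M_def by simp
        then show ?thesis using left.prems(3) \<Gamma> None by simp
      next
        case (Some K)
        then show ?thesis using left.hyps(2)[OF S] by simp
      qed
      from deriv.left[OF left.hyps(1) this] show ?thesis using \<Gamma> L by simp
    next
      case False
      with left.prems(2) obtain \<Gamma>1 where \<Gamma>1: "\<Gamma>' = add_mset (A \<^bold>\<Rightarrow> B) \<Gamma>1" "\<Gamma> = L + \<Gamma>1"
        by (metis non_principal)
      have "deriv False F (\<Delta> + add_mset (A \<^bold>\<Rightarrow> B) \<Gamma>1) (case c of None \<Rightarrow> G | Some H \<Rightarrow> H)"
        if S: "(\<Delta>, c) \<in> S" for \<Delta> c
      proof (cases c)
        case None
        \<comment> \<open>The induction hypothesis needs the derivation from \<open>B\<close> in the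
          context of the premise; inverting the rule provides it.\<close>
        have "deriv False F (\<Delta> + add_mset B \<Gamma>1) G"
          using left_rule_inv[OF left.hyps(1), of \<Delta> "add_mset B \<Gamma>1" G] left.prems(3) S None \<Gamma>1
          by simp
        then show ?thesis using left.IH[OF S, of "\<Delta> + \<Gamma>1"] None left.prems(1) \<Gamma>1 by simp
      next
        case (Some K)
        \<comment> \<open>A premise with its own goal is reused as it is, since
          \<open>A \<Rightarrow> B\<close> is still in its context.\<close>
        then show ?thesis using left.hyps(2)[OF S] \<Gamma>1 by simp
      qed
      from deriv.left[OF left.hyps(1) this] show ?thesis using \<Gamma>1 by simp
    qed
  qed
  then show ?thesis by (simp add: imp_left_admissible_def)
qed

lemma imp_left_admissible_False: "contractible False F A \<and> imp_left_admissible False F A"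
proof (induction A rule: measure_induct_rule[of fsize])
  case (less A)
  have "contractible False F A" by (rule contractible_step) (simp_all add: less)
  moreover have "imp_left_admissible False F A"
    by (rule imp_left_admissible_step) (simp_all add: less)
  ultimately show ?case ..
qed

lemma left_rule_True_cases:
  "left_rule k F L S \<Longrightarrow> k \<Longrightarrow>
    left_rule False F L S \<or> (\<exists>A B. L = {#A \<^bold>\<Rightarrow> B#} \<and> S = {({#A \<^bold>\<Rightarrow> B#}, Some A), ({#B#}, None)})"
  by (induction rule: left_rule.induct) (blast intro: left_rule.intros)+

lemma deriv_True_imp_False: "deriv True F \<Gamma> G \<Longrightarrow> deriv False F \<Gamma> G"
proof (induction rule: deriv.induct)
  case (axiom p ts \<Gamma>)
  then show ?case by (rule deriv.axiom)
next
  case (right G S \<Gamma>)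
  then show ?case by (metis deriv.right)
next
  case (left L S \<Gamma> G)
  show ?case
  proof (cases "left_rule False F L S")
    case True
    then show ?thesis using left.IH by (rule deriv.left)
  next
    case False
    then obtain A B where "L = {#A \<^bold>\<Rightarrow> B#}" "S = {({#A \<^bold>\<Rightarrow> B#}, Some A), ({#B#}, None)}"
      using left_rule_True_cases[OF left.hyps(1)] by auto
    then show ?thesis
      using imp_left_admissible_False[of F A] left.IH[of "{#A \<^bold>\<Rightarrow> B#}" "Some A"]
        left.IH[of "{#B#}" None] by (auto intro: imp_left_admissibleD)
  qed
qed

section \<open>A model of \<open>\<D>\<close> built from the contexts of \<open>\<K>\<close>\<close>

text \<open>The biorthogonal closure for the relation between contexts \<Gamma> and tests
  \<open>(\<Theta>, H)\<close> that holds when \<K> derives \<open>H\<close> from \<Gamma> and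
  \<Theta> together.\<close>

definition closure :: "('f \<times> nat) set \<Rightarrow> ('f, 'p) fm multiset set \<Rightarrow> ('f, 'p) fm multiset set" where
  "closure F X = {\<Gamma>. \<forall>\<Theta> H. (\<forall>\<Delta>\<in>X. deriv True F (\<Delta> + \<Theta>) H) \<longrightarrow> deriv True F (\<Gamma> + \<Theta>) H}"

lemma closureI:
  "(\<And>\<Theta> H. (\<And>\<Delta>. \<Delta> \<in> X \<Longrightarrow> deriv True F (\<Delta> + \<Theta>) H) \<Longrightarrow> deriv True F (\<Gamma> + \<Theta>) H) \<Longrightarrow> \<Gamma> \<in> closure F X"
  by (auto simp: closure_def)

lemma closureD:
  "\<Gamma> \<in> closure F X \<Longrightarrow> (\<And>\<Delta>. \<Delta> \<in> X \<Longrightarrow> deriv True F (\<Delta> + \<Theta>) H) \<Longrightarrow> deriv True F (\<Gamma> + \<Theta>) H"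
  by (auto simp: closure_def)

lemma closure_extensive: "\<Gamma> \<in> X \<Longrightarrow> \<Gamma> \<in> closure F X"
  by (auto simp: closure_def)

lemma closure_mono: "X \<subseteq> Y \<Longrightarrow> closure F X \<subseteq> closure F Y"
  by (force simp: closure_def)

lemma closure_idem: "closure F (closure F X) \<subseteq> closure F X"
  by (force simp: closure_def)

lemma closure_up: "\<Gamma> \<in> closure F X \<Longrightarrow> \<Gamma> \<subseteq># \<Delta> \<Longrightarrow> \<Delta> \<in> closure F X"
  by (rule closureI) (blast intro: weakening_mono[OF closureD] mset_subset_eq_mono_add)

text \<open>A Kripke model ordered by multiset inclusion. The recursion passes through instances and
  is not structural; it terminates because an instance has the size of the quantifier body.\<close>

function forces :: "('f \<times> nat) set \<Rightarrow> ('f, 'p) fm \<Rightarrow> ('f, 'p) fm multiset set" where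
  "forces F (Atom p ts) = {\<Gamma>. deriv True F \<Gamma> (Atom p ts)}"
| "forces F Top = UNIV"
| "forces F Bot = closure F {}"
| "forces F (A \<^bold>\<and> B) = forces F A \<inter> forces F B"
| "forces F (A \<^bold>\<or> B) = closure F (forces F A \<union> forces F B)"
| "forces F (A \<^bold>\<Rightarrow> B) = {\<Gamma>. \<forall>\<Delta>. \<Gamma> \<subseteq># \<Delta> \<longrightarrow> \<Delta> \<in> forces F A \<longrightarrow> \<Delta> \<in> forces F B}"
| "forces F (Forall A) = {\<Gamma>. \<forall>t. wf_tm F t \<longrightarrow> \<Gamma> \<in> forces F (instance_fm t A)}"
| "forces F (Exists A) = closure F {\<Gamma>. \<exists>t. wf_tm F t \<and> \<Gamma> \<in> forces F (instance_fm t A)}"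
  by pat_completeness auto
termination by (relation "measure (\<lambda>(F, A). fsize A)") auto

lemma contract_ctx: "deriv True F (\<Gamma> + \<Gamma> + \<Theta>) G \<Longrightarrow> deriv True F (\<Gamma> + \<Theta>) G"
  by (rule contract_mset) (rule contractible_True)

text \<open>Upward closure follows from closedness by \<open>closure_up\<close>. Atoms are closed by
  testing with the empty frame and the atom as goal, and conjunction and universal quantification
  are intersections of closed sets.\<close>

lemma forces_closed_up:
  "closure F (forces F A) \<subseteq> forces F A \<and> (\<forall>\<Gamma> \<Delta>. \<Gamma> \<in> forces F A \<longrightarrow> \<Gamma> \<subseteq># \<Delta> \<longrightarrow> \<Delta> \<in> forces F A)"
proof (induction A rule: measure_induct_rule[of fsize])
  case (less A)
  have "closure F (forces F A) \<subseteq> forces F A"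
  proof (cases A)
    case (Atom p ts)
    have "deriv True F \<Gamma> (Atom p ts)" if "\<Gamma> \<in> closure F {\<Gamma>. deriv True F \<Gamma> (Atom p ts)}" for \<Gamma>
      using closureD[OF that, of "{#}" "Atom p ts"] by simp
    then show ?thesis using Atom by auto
  next
    case (Conj B C)
    have "closure F (forces F B \<inter> forces F C) \<subseteq> closure F (forces F B) \<inter> closure F (forces F C)"
      by (simp add: closure_mono)
    then show ?thesis using Conj less[of B] less[of C] by auto
  next
    case (Imp B C)
    have "\<Delta> \<in> forces F C" if \<Gamma>: "\<Gamma> \<in> closure F (forces F A)" "\<Gamma> \<subseteq># \<Delta>" and \<Delta>: "\<Delta> \<in> forces F B" for \<Gamma> \<Delta>
    proof -
      have "\<Delta> \<in> closure F (forces F C)"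
      proof (rule closureI)
        fix \<Theta> H assume H: "\<And>\<Delta>. \<Delta> \<in> forces F C \<Longrightarrow> deriv True F (\<Delta> + \<Theta>) H"
        \<comment> \<open>Closure of the implication is tested with frame
          \<open>\<Delta> + \<Theta>\<close>, so that each \<Xi> forcing the implication meets
          \<Delta>, which forces the antecedent.\<close>
        have "deriv True F (\<Gamma> + (\<Delta> + \<Theta>)) H"
        proof (rule closureD[OF \<Gamma>(1)])
          fix \<Xi> assume "\<Xi> \<in> forces F A"
          moreover have "\<Xi> + \<Delta> \<in> forces F B" using \<Delta> less[of B] Imp by auto
          ultimately have "\<Xi> + \<Delta> \<in> forces F C" using Imp by auto
          then show "deriv True F (\<Xi> + (\<Delta> + \<Theta>)) H" using H by (simp add: add.assoc[symmetric])
        qed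
        \<comment> \<open>As \<Gamma> is contained in \<Delta>, weakening leaves \<Delta> twice, and
          contraction in \<K> merges the copies.\<close>
        then have "deriv True F (\<Delta> + \<Delta> + \<Theta>) H"
          using \<Gamma>(2) by (auto intro: weakening_mono simp: add.assoc)
        then show "deriv True F (\<Delta> + \<Theta>) H" by (rule contract_ctx)
      qed
      then show ?thesis using less[of C] Imp by auto
    qed
    then show ?thesis using Imp by auto
  next
    case (Forall B)
    have "\<Gamma> \<in> forces F (instance_fm t B)" if "\<Gamma> \<in> closure F (forces F A)" "wf_tm F t" for \<Gamma> t
    proof -
      have "forces F A \<subseteq> forces F (instance_fm t B)" using Forall that(2) by auto
      then have "\<Gamma> \<in> closure F (forces F (instance_fm t B))" using closure_mono that(1) by blast
      then show ?thesis using less[of "instance_fm t B"] Forall by auto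
    qed
    then show ?thesis using Forall by auto
  qed (simp_all add: closure_idem)
  then show ?case using closure_extensive closure_up by blast
qed

lemma forces_closed: "\<Gamma> \<in> closure F (forces F A) \<Longrightarrow> \<Gamma> \<in> forces F A"
  using forces_closed_up by blast

lemma forces_up: "\<Gamma> \<in> forces F A \<Longrightarrow> \<Gamma> \<subseteq># \<Delta> \<Longrightarrow> \<Delta> \<in> forces F A"
  using forces_closed_up by blast

text \<open>Elimination principle for the closures in \<open>forces\<close>: since the sets of
  forcing contexts are closed, one may pass to an extension of \<Gamma> lying in \<open>X\<close>
  itself. \<Gamma> is used both as a member of the closure and as frame, and is then
  contracted.\<close>

lemma closure_forces:
  assumes "\<Gamma> \<in> closure F X" and up: "\<And>\<Delta> \<Xi>. \<Delta> \<in> X \<Longrightarrow> \<Delta> \<subseteq># \<Xi> \<Longrightarrow> \<Xi> \<in> X"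
    and "\<And>\<Delta>. \<Gamma> \<subseteq># \<Delta> \<Longrightarrow> \<Delta> \<in> X \<Longrightarrow> \<Delta> \<in> forces F G"
  shows "\<Gamma> \<in> forces F G"
proof (rule forces_closed, rule closureI)
  fix \<Theta> H assume H: "\<And>\<Delta>. \<Delta> \<in> forces F G \<Longrightarrow> deriv True F (\<Delta> + \<Theta>) H"
  have "deriv True F (\<Gamma> + (\<Gamma> + \<Theta>)) H"
  proof (rule closureD[OF assms(1)])
    fix \<Delta> assume "\<Delta> \<in> X"
    then have "\<Delta> + \<Gamma> \<in> forces F G" using up assms(3) by simp
    then show "deriv True F (\<Delta> + (\<Gamma> + \<Theta>)) H" using H by (simp add: add.assoc[symmetric])
  qed
  then show "deriv True F (\<Gamma> + \<Theta>) H" using contract_ctx by (simp add: add.assoc[symmetric])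
qed

text \<open>A closed set that contains \<open>{#B#}\<close> contains each context that can replace
  \<open>B\<close> on the left. The left rules of \<K> thus transfer forcing from subformulas to
  formulas.\<close>

lemma forces_of_deriv:
  assumes "{#B#} \<in> forces F B" and "\<And>\<Theta> H. deriv True F (add_mset B \<Theta>) H \<Longrightarrow> deriv True F (\<Gamma> + \<Theta>) H"
  shows "\<Gamma> \<in> forces F B"
  by (rule forces_closed, rule closureI) (use assms in fastforce)

text \<open>The two halves need each other at implications: that \<open>B \<Rightarrow> C\<close>
  forces itself requires deriving \<open>B\<close> from contexts forcing it, and deriving
  \<open>B \<Rightarrow> C\<close> requires that \<open>B\<close> forces itself.\<close>

lemma forces_sandwich: "{#A#} \<in> forces F A \<and> (\<forall>\<Gamma>\<in>forces F A. deriv True F \<Gamma> A)"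
proof (induction A rule: measure_induct_rule[of fsize])
  case (less A)
  show ?case
  proof (cases A)
    case (Atom p ts)
    then show ?thesis by (auto intro: deriv.axiom)
  next
    case Top
    then show ?thesis by (simp add: deriv_TopR)
  next
    case Bot
    have "deriv True F \<Gamma> A" if "\<Gamma> \<in> forces F A" for \<Gamma>
      using that closureD[of \<Gamma> F "{}" "{#}" A] Bot by simp
    moreover have "{#A#} \<in> forces F A"
      unfolding Bot forces.simps by (rule closureI) (simp add: deriv_BotL)
    ultimately show ?thesis by blast
  next
    case (Conj B C)
    have B: "{#B#} \<in> forces F B" and C: "{#C#} \<in> forces F C" using less Conj by auto
    have "{#B \<^bold>\<and> C#} \<in> forces F B"
      using B by (rule forces_of_deriv) (auto intro!: deriv_ConjL intro: weakening_mono)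
    moreover have "{#B \<^bold>\<and> C#} \<in> forces F C"
      using C by (rule forces_of_deriv) (auto intro!: deriv_ConjL intro: weakening_mono)
    ultimately show ?thesis using less[of B] less[of C] Conj by (auto intro: deriv_ConjR)
  next
    case (Disj B C)
    have B: "{#B#} \<in> forces F B" and C: "{#C#} \<in> forces F C" using less Disj by auto
    have "{#B \<^bold>\<or> C#} \<in> forces F A" unfolding Disj forces.simps
    proof (rule closureI)
      fix \<Theta> H assume *: "\<And>\<Delta>. \<Delta> \<in> forces F B \<union> forces F C \<Longrightarrow> deriv True F (\<Delta> + \<Theta>) H"
      show "deriv True F ({#B \<^bold>\<or> C#} + \<Theta>) H" using *[of "{#B#}"] *[of "{#C#}"] B C
        by (simp add: deriv_DisjL)
    qed
    moreover have "deriv True F \<Gamma> A" if "\<Gamma> \<in> forces F A" for \<Gamma>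
    proof -
      have "deriv True F (\<Gamma> + {#}) A"
        by (rule closureD[OF that[unfolded Disj forces.simps]])
          (use less[of B] less[of C] Disj in \<open>auto intro: deriv_DisjR1 deriv_DisjR2\<close>)
      then show ?thesis by simp
    qed
    ultimately show ?thesis using Disj by blast
  next
    case (Imp B C)
    have B: "{#B#} \<in> forces F B" and C: "{#C#} \<in> forces F C" using less Imp by auto
    have "\<Delta> \<in> forces F C" if \<Delta>: "{#B \<^bold>\<Rightarrow> C#} \<subseteq># \<Delta>" "\<Delta> \<in> forces F B" for \<Delta>
      using C
    proof (rule forces_of_deriv)
      fix \<Theta> H assume H: "deriv True F (add_mset C \<Theta>) H"
      obtain \<Delta>' where \<Delta>': "\<Delta> = add_mset (B \<^bold>\<Rightarrow> C) \<Delta>'" using \<Delta>(1) by (metis insert_DiffM insert_subset_eq_iff)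
      have "deriv True F (add_mset (B \<^bold>\<Rightarrow> C) (\<Delta>' + \<Theta>)) H"
      proof (rule deriv_ImpL)
        have "deriv True F \<Delta> B" using less[of B] Imp \<Delta>(2) by auto
        then show "deriv True F (add_mset (B \<^bold>\<Rightarrow> C) (\<Delta>' + \<Theta>)) B"
          using \<Delta>' by (auto intro: weakening_mono)
        show "deriv True F (add_mset C (\<Delta>' + \<Theta>)) H" using H by (auto intro: weakening_mono)
      qed
      then show "deriv True F (\<Delta> + \<Theta>) H" using \<Delta>' by simp
    qed
    moreover have "deriv True F \<Gamma> (B \<^bold>\<Rightarrow> C)" if "\<Gamma> \<in> forces F A" for \<Gamma>
    proof (rule deriv_ImpR)
      have "add_mset B \<Gamma> \<in> forces F B" using B by (rule forces_up) simp
      then have "add_mset B \<Gamma> \<in> forces F C" using that Imp by simp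
      then show "deriv True F (add_mset B \<Gamma>) C" using less[of C] Imp by auto
    qed
    ultimately show ?thesis using Imp by auto
  next
    case (Forall B)
    have "{#Forall B#} \<in> forces F (instance_fm t B)" if "wf_tm F t" for t
    proof (rule forces_of_deriv)
      show "{#instance_fm t B#} \<in> forces F (instance_fm t B)" using less Forall by auto
      fix \<Theta> H assume "deriv True F (add_mset (instance_fm t B) \<Theta>) H"
      then have "deriv True F (add_mset (Forall B) (add_mset (instance_fm t B) \<Theta>)) H"
        by (auto intro: weakening_mono)
      then show "deriv True F ({#Forall B#} + \<Theta>) H" using that by (simp add: deriv_AllL)
    qed
    moreover have "deriv True F \<Gamma> A" if "\<Gamma> \<in> forces F A" for \<Gamma>
      unfolding Forall using that less Forall by (intro deriv_AllR) auto
    ultimately show ?thesis using Forall by auto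
  next
    case (Exists B)
    have "{#Exists B#} \<in> forces F A" unfolding Exists forces.simps
    proof (rule closureI)
      fix \<Theta> H
      assume *: "\<And>\<Delta>. \<Delta> \<in> {\<Gamma>. \<exists>t. wf_tm F t \<and> \<Gamma> \<in> forces F (instance_fm t B)} \<Longrightarrow> deriv True F (\<Delta> + \<Theta>) H"
      have "deriv True F (add_mset (instance_fm t B) \<Theta>) H" if "wf_tm F t" for t
        using *[of "{#instance_fm t B#}"] less[of "instance_fm t B"] Exists that by auto
      then show "deriv True F ({#Exists B#} + \<Theta>) H" by (simp add: deriv_ExL)
    qed
    moreover have "deriv True F \<Gamma> A" if "\<Gamma> \<in> forces F A" for \<Gamma>
    proof -
      have "deriv True F (\<Gamma> + {#}) A"
        by (rule closureD[OF that[unfolded Exists forces.simps]])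
          (use less[of "instance_fm _ B"] Exists in \<open>auto intro!: deriv_ExR\<close>)
      then show ?thesis by simp
    qed
    ultimately show ?thesis using Exists by blast
  qed
qed

section \<open>Soundness of \<D> in the model\<close>

lemma forces_right_rule:
  assumes "right_rule F G S" "\<And>\<Delta> H \<Xi>. (\<Delta>, H) \<in> S \<Longrightarrow> \<Gamma> \<subseteq># \<Xi> \<Longrightarrow> (\<forall>A\<in>#\<Delta>. \<Xi> \<in> forces F A) \<Longrightarrow> \<Xi> \<in> forces F H"
  shows "\<Gamma> \<in> forces F G"
  using assms(1)
proof (cases rule: right_rule.cases)
  case (ConjR A B)
  then show ?thesis using assms(2)[of "{#}" A \<Gamma>] assms(2)[of "{#}" B \<Gamma>] by simp
next
  case (ExR t A)
  then show ?thesis using assms(2)[of "{#}" "instance_fm t A" \<Gamma>] by (auto intro!: closure_extensive)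
qed (use assms(2) in \<open>auto intro!: closure_extensive\<close>)

lemma forces_impD: "\<Gamma> \<in> forces F (A \<^bold>\<Rightarrow> B) \<Longrightarrow> \<Gamma> \<subseteq># \<Delta> \<Longrightarrow> \<Delta> \<in> forces F A \<Longrightarrow> \<Delta> \<in> forces F B"
  by simp

lemma forces_left_rule:
  assumes "left_rule False F L S" "\<forall>A\<in>#L. \<Gamma> \<in> forces F A"
    and prem: "\<And>\<Delta> c \<Xi>. (\<Delta>, c) \<in> S \<Longrightarrow> \<Gamma> \<subseteq># \<Xi> \<Longrightarrow> (\<forall>A\<in>#\<Delta>. \<Xi> \<in> forces F A) \<Longrightarrow>
      \<Xi> \<in> forces F (case c of None \<Rightarrow> G | Some H \<Rightarrow> H)"
  shows "\<Gamma> \<in> forces F G"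
  using assms(1)
proof (cases rule: left_rule.cases)
  case BotL
  then show ?thesis using assms(2) closure_forces[of \<Gamma> F "{}" G] by simp
next
  case (ConjL A B)
  then show ?thesis using assms(2) prem[of "{#A, B#}" None \<Gamma>] by simp
next
  case (DisjL A B)
  then have "\<Gamma> \<in> closure F (forces F A \<union> forces F B)" using assms(2) by simp
  then show ?thesis
  proof (rule closure_forces)
    show "\<Delta> \<in> forces F G" if "\<Gamma> \<subseteq># \<Delta>" "\<Delta> \<in> forces F A \<union> forces F B" for \<Delta>
      using prem[of "{#A#}" None \<Delta>] prem[of "{#B#}" None \<Delta>] DisjL that by auto
  qed (blast intro: forces_up)
next
  case (AllL t A)
  then show ?thesis using assms(2) prem[of "{#Forall A, instance_fm t A#}" None \<Gamma>] by simp
next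
  case (ExL A)
  then have "\<Gamma> \<in> closure F {\<Gamma>. \<exists>t. wf_tm F t \<and> \<Gamma> \<in> forces F (instance_fm t A)}" using assms(2) by simp
  then show ?thesis
  proof (rule closure_forces)
    show "\<Delta> \<in> forces F G" if "\<Gamma> \<subseteq># \<Delta>" "\<Delta> \<in> {\<Gamma>. \<exists>t. wf_tm F t \<and> \<Gamma> \<in> forces F (instance_fm t A)}" for \<Delta>
      using prem[of "{#instance_fm t A#}" None \<Delta> for t] ExL that by auto
  qed (blast intro: forces_up)
next
  case (ImpL_axiom p ts B)
  then have "\<Gamma> \<in> forces F B" using assms(2) forces_impD[of \<Gamma> F "Atom p ts" B \<Gamma>] by simp
  then show ?thesis using ImpL_axiom assms(2) prem[of "{#Atom p ts, B#}" None \<Gamma>] by simp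
next
  case (ImpL_Top B)
  then show ?thesis using assms(2) prem[of "{#B#}" None \<Gamma>] by simp
next
  case (ImpL_Conj C E B)
  have imp: "\<Gamma> \<in> forces F ((C \<^bold>\<and> E) \<^bold>\<Rightarrow> B)" using ImpL_Conj assms(2) by simp
  \<comment> \<open>Where \<open>C\<close> is forced, \<open>(C \<and> E) \<Rightarrow> B\<close>
    amounts to \<open>E \<Rightarrow> B\<close>, and the second premise yields \<open>E\<close>.
    Hence \<open>C\<close> alone leads to \<open>B\<close>, which the first premise needs in order
    to yield \<open>C\<close>.\<close>
  have E: "\<Xi> \<in> forces F E" if "\<Gamma> \<subseteq># \<Xi>" "\<Xi> \<in> forces F C" for \<Xi>
  proof -
    have "\<Xi> \<in> forces F (E \<^bold>\<Rightarrow> B)" using imp that by (auto intro: forces_up subset_mset.trans)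
    then show ?thesis using prem[of "{#E \<^bold>\<Rightarrow> B#}" "Some E" \<Xi>] ImpL_Conj that by simp
  qed
  then have "\<Gamma> \<in> forces F (C \<^bold>\<Rightarrow> B)" using imp by simp
  then have "\<Gamma> \<in> forces F C" using prem[of "{#C \<^bold>\<Rightarrow> B#}" "Some C" \<Gamma>] ImpL_Conj by simp
  then have "\<Gamma> \<in> forces F B" using imp E by simp
  then show ?thesis using prem[of "{#B#}" None \<Gamma>] ImpL_Conj by simp
next
  case (ImpL_Disj1 C E B)
  have imp: "\<Gamma> \<in> forces F ((C \<^bold>\<or> E) \<^bold>\<Rightarrow> B)" using ImpL_Disj1 assms(2) by simp
  then have "\<Gamma> \<in> forces F (C \<^bold>\<Rightarrow> B)" "\<Gamma> \<in> forces F (E \<^bold>\<Rightarrow> B)" by (simp_all add: closure_extensive)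
  then have "\<Gamma> \<in> forces F C" "\<Gamma> \<in> forces F (C \<^bold>\<Rightarrow> B)"
    using prem[of "{#C \<^bold>\<Rightarrow> B, E \<^bold>\<Rightarrow> B#}" "Some C" \<Gamma>] ImpL_Disj1 by simp_all
  then have "\<Gamma> \<in> forces F B" by simp
  then show ?thesis using prem[of "{#B#}" None \<Gamma>] ImpL_Disj1 by simp
next
  case (ImpL_Disj2 C E B)
  have imp: "\<Gamma> \<in> forces F ((C \<^bold>\<or> E) \<^bold>\<Rightarrow> B)" using ImpL_Disj2 assms(2) by simp
  then have "\<Gamma> \<in> forces F (C \<^bold>\<Rightarrow> B)" "\<Gamma> \<in> forces F (E \<^bold>\<Rightarrow> B)" by (simp_all add: closure_extensive)
  then have "\<Gamma> \<in> forces F E" "\<Gamma> \<in> forces F (E \<^bold>\<Rightarrow> B)"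
    using prem[of "{#C \<^bold>\<Rightarrow> B, E \<^bold>\<Rightarrow> B#}" "Some E" \<Gamma>] ImpL_Disj2 by simp_all
  then have "\<Gamma> \<in> forces F B" by simp
  then show ?thesis using prem[of "{#B#}" None \<Gamma>] ImpL_Disj2 by simp
next
  case (ImpL_Imp C E B)
  have imp: "\<Gamma> \<in> forces F ((C \<^bold>\<Rightarrow> E) \<^bold>\<Rightarrow> B)" using ImpL_Imp assms(2) by simp
  have "\<Xi> \<in> forces F E" if \<Xi>: "\<Gamma> \<subseteq># \<Xi>" "\<Xi> \<in> forces F C" for \<Xi>
  proof -
    \<comment> \<open>Forcing \<open>E\<close> entails forcing \<open>C \<Rightarrow> E\<close>, so
      \<Xi> forces \<open>E \<Rightarrow> B\<close>; the premise, whose context also contains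
      \<open>C\<close>, then yields \<open>E\<close>.\<close>
    have "\<Delta> \<in> forces F B" if "\<Xi> \<subseteq># \<Delta>" "\<Delta> \<in> forces F E" for \<Delta>
    proof (rule forces_impD[OF imp])
      show "\<Gamma> \<subseteq># \<Delta>" using \<Xi>(1) that(1) by (rule subset_mset.trans)
      show "\<Delta> \<in> forces F (C \<^bold>\<Rightarrow> E)" using that(2) by (auto intro: forces_up)
    qed
    then show ?thesis using prem[of "{#E \<^bold>\<Rightarrow> B, C#}" "Some E" \<Xi>] ImpL_Imp \<Xi> by simp
  qed
  then have "\<Gamma> \<in> forces F (C \<^bold>\<Rightarrow> E)" by simp
  then have "\<Gamma> \<in> forces F B" by (rule forces_impD[OF imp subset_mset.order_refl])
  then show ?thesis using prem[of "{#B#}" None \<Gamma>] ImpL_Imp by simp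
next
  case (ImpL_All C B)
  have imp: "\<Gamma> \<in> forces F (Forall C \<^bold>\<Rightarrow> B)" using ImpL_All assms(2) by simp
  then have "\<Gamma> \<in> forces F (instance_fm t C)" if "wf_tm F t" for t
    using prem[of "{#Forall C \<^bold>\<Rightarrow> B#}" "Some (instance_fm t C)" \<Gamma>] ImpL_All that by auto
  then have "\<Gamma> \<in> forces F (Forall C)" by simp
  then have "\<Gamma> \<in> forces F B" by (rule forces_impD[OF imp subset_mset.order_refl])
  then show ?thesis using prem[of "{#B#}" None \<Gamma>] ImpL_All by simp
next
  case (ImpL_Ex t C B)
  have imp: "\<Gamma> \<in> forces F (Exists C \<^bold>\<Rightarrow> B)" using ImpL_Ex assms(2) by simp
  then have "\<Gamma> \<in> forces F (instance_fm t C)"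
    using prem[of "{#Exists C \<^bold>\<Rightarrow> B#}" "Some (instance_fm t C)" \<Gamma>] ImpL_Ex by simp
  then have "\<Gamma> \<in> forces F (Exists C)" using ImpL_Ex by (auto intro!: closure_extensive)
  then have "\<Gamma> \<in> forces F B" by (rule forces_impD[OF imp subset_mset.order_refl])
  then show ?thesis using prem[of "{#B#}" None \<Gamma>] ImpL_Ex by simp
qed simp

lemma forces_sound: "deriv False F \<Gamma> G \<Longrightarrow> (\<forall>A\<in>#\<Gamma>. \<Xi> \<in> forces F A) \<Longrightarrow> \<Xi> \<in> forces F G"
proof (induction arbitrary: \<Xi> rule: deriv.induct)
  case (axiom p ts \<Gamma>)
  then show ?case by blast
next
  case (right G S \<Gamma>)
  show ?case
    by (rule forces_right_rule[OF right.hyps(1)], rule right.IH) (use right.prems in \<open>auto intro: forces_up\<close>)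
next
  case (left L S \<Gamma> G)
  show ?case
    by (rule forces_left_rule[OF left.hyps(1)]; (rule left.IH)?) (use left.prems in \<open>auto intro: forces_up\<close>)
qed

lemma deriv_False_imp_True:
  assumes "deriv False F \<Gamma> G"
  shows "deriv True F \<Gamma> G"
proof -
  \<comment> \<open>Soundness is evaluated at the world \<Gamma> itself, which forces each of its
    members because it extends their singletons.\<close>
  have "\<Gamma> \<in> forces F A" if "A \<in># \<Gamma>" for A
    by (rule forces_up[of "{#A#}"]) (use forces_sandwich that in auto)
  then show ?thesis using forces_sound[OF assms] forces_sandwich by blast
qed

section \<open>Eigenvariables\<close>

lemma subst_fm_all: "subst_fm s (all x A) = Forall (subst_fm (lift_subst s) (bind x A))"
  by (simp add: all_def)

lemma subst_fm_ex: "subst_fm s (ex x A) = Exists (subst_fm (lift_subst s) (bind x A))"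
  by (simp add: ex_def)

lemma subst_fm_fresh: "x \<notin> fv A \<Longrightarrow> subst_fm (s(x := t)) A = subst_fm s A"
  by (rule subst_fm_cong) auto

lemma subst_ctx_fresh:
  "x \<notin> fv_ctx \<Gamma> \<Longrightarrow> image_mset (subst_fm (s(x := t))) \<Gamma> = image_mset (subst_fm s) \<Gamma>"
  by (rule image_mset_cong) (auto simp: fv_ctx_def intro: subst_fm_fresh)

lemma wf_subst_upd: "\<forall>n. wf_tm F (s n) \<Longrightarrow> wf_tm F t \<Longrightarrow> \<forall>n. wf_tm F ((s(x := t)) n)"
  by simp

text \<open>Generalising over substitutions by terms of the language makes the induction work: at an
  eigenvariable rule, updating \<open>s\<close> at \<open>x\<close> gives the premise for each term,
  and freshness leaves the rest of the sequent unchanged.\<close>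

lemma derivD_imp_deriv_subst:
  assumes "derivD F \<Gamma> G" "\<forall>n. wf_tm F (s n)"
  shows "deriv False F (image_mset (subst_fm s) \<Gamma>) (subst_fm s G)"
  using assms
proof (induction arbitrary: s rule: derivD.induct)
  case (D_AllR \<Gamma> A x)
  have "deriv False F (image_mset (subst_fm s) \<Gamma>) (subst_fm (s(x := t)) A)" if "wf_tm F t" for t
    using D_AllR.IH[of "s(x := t)", OF wf_subst_upd[OF D_AllR.prems that]] D_AllR.hyps by (simp add: subst_ctx_fresh del: fun_upd_apply)
  then show ?case unfolding subst_fm_all by (intro deriv_AllR) (simp add: instance_fm_subst_bind)
next
  case (D_AllL x A t \<Gamma> G)
  have "wf_tm F (subst_tm s t)" using D_AllL by (simp add: wf_tm_subst_tm)
  then show ?case using D_AllL.IH[OF D_AllL.prems]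
    by (auto simp: subst_fm_all subst_fm_inst instance_fm_subst_bind intro: deriv_AllL)
next
  case (D_ExL A \<Gamma> G x)
  have "deriv False F (add_mset (subst_fm (s(x := t)) A) (image_mset (subst_fm s) \<Gamma>)) (subst_fm s G)"
    if "wf_tm F t" for t
    using D_ExL.IH[of "s(x := t)", OF wf_subst_upd[OF D_ExL.prems that]] D_ExL.hyps
    by (simp add: subst_ctx_fresh subst_fm_fresh del: fun_upd_apply)
  then show ?case unfolding subst_fm_ex image_mset_add_mset
    by (intro deriv_ExL) (simp add: instance_fm_subst_bind)
next
  case (D_ExR \<Gamma> t x A)
  have "wf_tm F (subst_tm s t)" using D_ExR by (simp add: wf_tm_subst_tm)
  then show ?case using D_ExR.IH[OF D_ExR.prems]
    by (auto simp: subst_fm_ex subst_fm_inst instance_fm_subst_bind intro: deriv_ExR)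
next
  case (D_ImpL_All x C B \<Gamma> G)
  \<comment> \<open>The implication kept in the premise is thus unaffected by updating the
    substitution at \<open>x\<close>.\<close>
  have "x \<notin> fv (all x C)" by (simp add: fv_all)
  then have "deriv False F (add_mset (subst_fm s (all x C) \<^bold>\<Rightarrow> subst_fm s B) (image_mset (subst_fm s) \<Gamma>))
      (subst_fm (s(x := t)) C)" if "wf_tm F t" for t
    using D_ImpL_All.IH(1)[of "s(x := t)", OF wf_subst_upd[OF D_ImpL_All.prems that]] D_ImpL_All.hyps
    by (simp add: subst_ctx_fresh subst_fm_fresh del: fun_upd_apply)
  then show ?case using D_ImpL_All.IH(2)[OF D_ImpL_All.prems]
    by (simp add: subst_fm_all instance_fm_subst_bind deriv_ImpL_All)
next
  case (D_ImpL_Ex x C B \<Gamma> t G)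
  have "wf_tm F (subst_tm s t)" using D_ImpL_Ex by (simp add: wf_tm_subst_tm)
  then show ?case using D_ImpL_Ex.IH(1)[OF D_ImpL_Ex.prems] D_ImpL_Ex.IH(2)[OF D_ImpL_Ex.prems]
    by (auto simp: subst_fm_ex subst_fm_inst instance_fm_subst_bind intro: deriv_ImpL_Ex)
qed (simp_all add: deriv.axiom deriv_TopR deriv_BotL deriv_ConjL deriv_ConjR deriv_DisjL deriv_DisjR1
  deriv_DisjR2 deriv_ImpR deriv_ImpL_axiom deriv_ImpL_Top deriv_ImpL_Conj deriv_ImpL_Disj1
  deriv_ImpL_Disj2 deriv_ImpL_Imp)

lemma derivK_imp_deriv_subst:
  assumes "derivK F \<Gamma> G" "\<forall>n. wf_tm F (s n)"
  shows "deriv True F (image_mset (subst_fm s) \<Gamma>) (subst_fm s G)"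
  using assms
proof (induction arbitrary: s rule: derivK.induct)
  case (K_AllR \<Gamma> A x)
  have "deriv True F (image_mset (subst_fm s) \<Gamma>) (subst_fm (s(x := t)) A)" if "wf_tm F t" for t
    using K_AllR.IH[of "s(x := t)", OF wf_subst_upd[OF K_AllR.prems that]] K_AllR.hyps by (simp add: subst_ctx_fresh del: fun_upd_apply)
  then show ?case unfolding subst_fm_all by (intro deriv_AllR) (simp add: instance_fm_subst_bind)
next
  case (K_AllL x A t \<Gamma> G)
  have "wf_tm F (subst_tm s t)" using K_AllL by (simp add: wf_tm_subst_tm)
  then show ?case using K_AllL.IH[OF K_AllL.prems]
    by (auto simp: subst_fm_all subst_fm_inst instance_fm_subst_bind intro: deriv_AllL)
next
  case (K_ExL A \<Gamma> G x)
  have "deriv True F (add_mset (subst_fm (s(x := t)) A) (image_mset (subst_fm s) \<Gamma>)) (subst_fm s G)"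
    if "wf_tm F t" for t
    using K_ExL.IH[of "s(x := t)", OF wf_subst_upd[OF K_ExL.prems that]] K_ExL.hyps
    by (simp add: subst_ctx_fresh subst_fm_fresh del: fun_upd_apply)
  then show ?case unfolding subst_fm_ex image_mset_add_mset
    by (intro deriv_ExL) (simp add: instance_fm_subst_bind)
next
  case (K_ExR \<Gamma> t x A)
  have "wf_tm F (subst_tm s t)" using K_ExR by (simp add: wf_tm_subst_tm)
  then show ?case using K_ExR.IH[OF K_ExR.prems]
    by (auto simp: subst_fm_ex subst_fm_inst instance_fm_subst_bind intro: deriv_ExR)
next
  case (K_ImpL A B \<Gamma> G)
  then show ?case using K_ImpL.IH(1)[OF K_ImpL.prems] K_ImpL.IH(2)[OF K_ImpL.prems]
    by (auto intro: deriv_ImpL)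
qed (simp_all add: deriv.axiom deriv_TopR deriv_BotL deriv_ConjL deriv_ConjR deriv_DisjL deriv_DisjR1
  deriv_DisjR2 deriv_ImpR)

section \<open>From infinitary rules back to eigenvariable rules\<close>

lemma subst_fm_Var_id: "subst_fm Var = (\<lambda>A. A)"
  by (rule ext) (rule subst_fm_Var)

text \<open>Recovers named syntax: a quantifier body is the binding of its own instance at a fresh
  variable, so the rules for \<open>all\<close> and \<open>ex\<close> apply to arbitrary quantified
  formulas.\<close>

lemma fresh_bind: "Suc x \<notin> fv A \<Longrightarrow> bind x (instance_fm (Var x) A) = A"
  using bind_surj[of x A] by (simp add: instance_fm_def)

lemma all_instance_fm: "Suc x \<notin> fv A \<Longrightarrow> all x (instance_fm (Var x) A) = Forall A"
  by (simp add: all_def fresh_bind)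

lemma ex_instance_fm: "Suc x \<notin> fv A \<Longrightarrow> ex x (instance_fm (Var x) A) = Exists A"
  by (simp add: ex_def fresh_bind)

lemma inst_instance_fm: "Suc x \<notin> fv A \<Longrightarrow> inst t x (instance_fm (Var x) A) = instance_fm t A"
  using instance_fm_bind[of t x "instance_fm (Var x) A"] by (simp add: fresh_bind)

lemma fresh_variable:
  obtains x where "Suc x \<notin> fv A" "x \<notin> fv_ctx \<Gamma>" "x \<notin> fv G" "x \<notin> fv B"
proof -
  \<comment> \<open>Freshness for \<open>Forall A\<close> reads \<open>Suc x \<notin> fv A\<close>,
    since free variables are shifted by one under the quantifier.\<close>
  obtain x where "x \<notin> fv (Forall A) \<union> fv_ctx \<Gamma> \<union> fv G \<union> fv B"
    using ex_fresh finite_fv finite_fv_ctx by (metis finite_UnI)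
  then show thesis using that[of x] by simp
qed

text \<open>Variables are terms of every language, so the family of premises includes the one for a
  fresh \<open>Var x\<close>, which is the premise of the eigenvariable rule.\<close>

lemma derivK_AllR':
  assumes "\<And>t. wf_tm F t \<Longrightarrow> derivK F \<Gamma> (instance_fm t A)"
  shows "derivK F \<Gamma> (Forall A)"
proof -
  obtain x where "Suc x \<notin> fv A" "x \<notin> fv_ctx \<Gamma>" by (rule fresh_variable)
  then show ?thesis using K_AllR[of F \<Gamma> "instance_fm (Var x) A" x] assms by (simp add: all_instance_fm)
qed

lemma derivK_ExR':
  assumes "derivK F \<Gamma> (instance_fm t A)" "wf_tm F t"
  shows "derivK F \<Gamma> (Exists A)"
proof -
  obtain x where "Suc x \<notin> fv A" by (rule fresh_variable)
  then show ?thesis using K_ExR[of F \<Gamma> t x "instance_fm (Var x) A"] assms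
    by (simp add: ex_instance_fm inst_instance_fm)
qed

lemma derivK_AllL':
  assumes "derivK F (add_mset (Forall A) (add_mset (instance_fm t A) \<Gamma>)) G" "wf_tm F t"
  shows "derivK F (add_mset (Forall A) \<Gamma>) G"
proof -
  obtain x where "Suc x \<notin> fv A" by (rule fresh_variable)
  then show ?thesis using K_AllL[of F x "instance_fm (Var x) A" t \<Gamma> G] assms
    by (simp add: all_instance_fm inst_instance_fm)
qed

lemma derivK_ExL':
  assumes "\<And>t. wf_tm F t \<Longrightarrow> derivK F (add_mset (instance_fm t A) \<Gamma>) G"
  shows "derivK F (add_mset (Exists A) \<Gamma>) G"
proof -
  obtain x where "Suc x \<notin> fv A" "x \<notin> fv_ctx \<Gamma>" "x \<notin> fv G" by (rule fresh_variable)
  then show ?thesis using K_ExL[of F "instance_fm (Var x) A" \<Gamma> G x] assms by (simp add: ex_instance_fm)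
qed

lemma derivD_AllR':
  assumes "\<And>t. wf_tm F t \<Longrightarrow> derivD F \<Gamma> (instance_fm t A)"
  shows "derivD F \<Gamma> (Forall A)"
proof -
  obtain x where "Suc x \<notin> fv A" "x \<notin> fv_ctx \<Gamma>" by (rule fresh_variable)
  then show ?thesis using D_AllR[of F \<Gamma> "instance_fm (Var x) A" x] assms by (simp add: all_instance_fm)
qed

lemma derivD_ExR':
  assumes "derivD F \<Gamma> (instance_fm t A)" "wf_tm F t"
  shows "derivD F \<Gamma> (Exists A)"
proof -
  obtain x where "Suc x \<notin> fv A" by (rule fresh_variable)
  then show ?thesis using D_ExR[of F \<Gamma> t x "instance_fm (Var x) A"] assms
    by (simp add: ex_instance_fm inst_instance_fm)
qed

lemma derivD_AllL':
  assumes "derivD F (add_mset (Forall A) (add_mset (instance_fm t A) \<Gamma>)) G" "wf_tm F t"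
  shows "derivD F (add_mset (Forall A) \<Gamma>) G"
proof -
  obtain x where "Suc x \<notin> fv A" by (rule fresh_variable)
  then show ?thesis using D_AllL[of F x "instance_fm (Var x) A" t \<Gamma> G] assms
    by (simp add: all_instance_fm inst_instance_fm)
qed

lemma derivD_ExL':
  assumes "\<And>t. wf_tm F t \<Longrightarrow> derivD F (add_mset (instance_fm t A) \<Gamma>) G"
  shows "derivD F (add_mset (Exists A) \<Gamma>) G"
proof -
  obtain x where "Suc x \<notin> fv A" "x \<notin> fv_ctx \<Gamma>" "x \<notin> fv G" by (rule fresh_variable)
  then show ?thesis using D_ExL[of F "instance_fm (Var x) A" \<Gamma> G x] assms by (simp add: ex_instance_fm)
qed

lemma derivD_ImpL_All':
  assumes "\<And>t. wf_tm F t \<Longrightarrow> derivD F (add_mset (Forall C \<^bold>\<Rightarrow> B) \<Gamma>) (instance_fm t C)"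
    "derivD F (add_mset B \<Gamma>) G"
  shows "derivD F (add_mset (Forall C \<^bold>\<Rightarrow> B) \<Gamma>) G"
proof -
  obtain x where "Suc x \<notin> fv C" "x \<notin> fv_ctx \<Gamma>" "x \<notin> fv B" by (rule fresh_variable)
  then show ?thesis using D_ImpL_All[of F x "instance_fm (Var x) C" B \<Gamma> G] assms
    by (simp add: all_instance_fm)
qed

lemma derivD_ImpL_Ex':
  assumes "derivD F (add_mset (Exists C \<^bold>\<Rightarrow> B) \<Gamma>) (instance_fm t C)" "wf_tm F t"
    "derivD F (add_mset B \<Gamma>) G"
  shows "derivD F (add_mset (Exists C \<^bold>\<Rightarrow> B) \<Gamma>) G"
proof -
  obtain x where "Suc x \<notin> fv C" by (rule fresh_variable)
  then show ?thesis using D_ImpL_Ex[of F x "instance_fm (Var x) C" B \<Gamma> t G] assms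
    by (simp add: ex_instance_fm inst_instance_fm)
qed

lemma left_ruleK:
  assumes "left_rule k F L S" "k"
    and "\<And>\<Delta> c. (\<Delta>, c) \<in> S \<Longrightarrow> derivK F (\<Delta> + \<Gamma>) (case c of None \<Rightarrow> G | Some H \<Rightarrow> H)"
  shows "derivK F (L + \<Gamma>) G"
  using assms
proof (induction rule: left_rule.induct)
  case (AllL t A)
  then show ?case using derivK_AllL'[of F A t \<Gamma> G] by fastforce
next
  case (ExL A)
  have "derivK F (add_mset (instance_fm t A) \<Gamma>) G" if "wf_tm F t" for t
    using ExL(2)[of "{#instance_fm t A#}" None] that by auto
  then show ?case by (simp add: derivK_ExL')
next
  case (ImpL A B)
  then show ?case using ImpL(3)[of "{#A \<^bold>\<Rightarrow> B#}" "Some A"] ImpL(3)[of "{#B#}" None] K_ImpL by simp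
qed (force intro: derivK.intros)+

lemma right_ruleK:
  assumes "right_rule F G S" "\<And>\<Delta> H. (\<Delta>, H) \<in> S \<Longrightarrow> derivK F (\<Delta> + \<Gamma>) H"
  shows "derivK F \<Gamma> G"
  using assms
proof (induction rule: right_rule.induct)
  case (AllR A)
  then show ?case by (intro derivK_AllR') force
next
  case (ExR t A)
  then show ?case by (intro derivK_ExR'[of F \<Gamma> t]) force+
qed (force intro: derivK.intros)+

lemma left_ruleD:
  assumes "left_rule k F L S" "\<not> k"
    and "\<And>\<Delta> c. (\<Delta>, c) \<in> S \<Longrightarrow> derivD F (\<Delta> + \<Gamma>) (case c of None \<Rightarrow> G | Some H \<Rightarrow> H)"
  shows "derivD F (L + \<Gamma>) G"
  using assms
proof (induction rule: left_rule.induct)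
  case (AllL t A)
  then show ?case using derivD_AllL'[of F A t \<Gamma> G] by fastforce
next
  case (ExL A)
  have "derivD F (add_mset (instance_fm t A) \<Gamma>) G" if "wf_tm F t" for t
    using ExL(2)[of "{#instance_fm t A#}" None] that by auto
  then show ?case by (simp add: derivD_ExL')
next
  case (ImpL_Conj C E B)
  then show ?case using ImpL_Conj(3)[of "{#C \<^bold>\<Rightarrow> B#}" "Some C"] ImpL_Conj(3)[of "{#E \<^bold>\<Rightarrow> B#}" "Some E"]
      ImpL_Conj(3)[of "{#B#}" None] D_ImpL_Conj by simp
next
  case (ImpL_Disj1 C E B)
  then show ?case using ImpL_Disj1(3)[of "{#C \<^bold>\<Rightarrow> B, E \<^bold>\<Rightarrow> B#}" "Some C"]
      ImpL_Disj1(3)[of "{#B#}" None] D_ImpL_Disj1 by simp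
next
  case (ImpL_Disj2 C E B)
  then show ?case using ImpL_Disj2(3)[of "{#C \<^bold>\<Rightarrow> B, E \<^bold>\<Rightarrow> B#}" "Some E"]
      ImpL_Disj2(3)[of "{#B#}" None] D_ImpL_Disj2 by simp
next
  case (ImpL_Imp C E B)
  then show ?case using ImpL_Imp(3)[of "{#E \<^bold>\<Rightarrow> B, C#}" "Some E"]
      ImpL_Imp(3)[of "{#B#}" None] D_ImpL_Imp by simp
next
  case (ImpL_All C B)
  have "derivD F (add_mset (Forall C \<^bold>\<Rightarrow> B) \<Gamma>) (instance_fm t C)" if "wf_tm F t" for t
    using ImpL_All(3)[of "{#Forall C \<^bold>\<Rightarrow> B#}" "Some (instance_fm t C)"] that by auto
  then show ?case using ImpL_All(3)[of "{#B#}" None] by (simp add: derivD_ImpL_All')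
next
  case (ImpL_Ex t C B)
  then show ?case using ImpL_Ex(4)[of "{#Exists C \<^bold>\<Rightarrow> B#}" "Some (instance_fm t C)"]
      ImpL_Ex(4)[of "{#B#}" None] derivD_ImpL_Ex'[of F C B \<Gamma> t G] by simp
qed (force intro: derivD.intros)+

lemma right_ruleD:
  assumes "right_rule F G S" "\<And>\<Delta> H. (\<Delta>, H) \<in> S \<Longrightarrow> derivD F (\<Delta> + \<Gamma>) H"
  shows "derivD F \<Gamma> G"
  using assms
proof (induction rule: right_rule.induct)
  case (AllR A)
  then show ?case by (intro derivD_AllR') force
next
  case (ExR t A)
  then show ?case by (intro derivD_ExR'[of F \<Gamma> t]) force+
qed (force intro: derivD.intros)+

section \<open>Equivalence of the calculi\<close>

lemma derivK_iff_deriv: "derivK F \<Gamma> G \<longleftrightarrow> deriv True F \<Gamma> G"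
proof
  assume "derivK F \<Gamma> G"
  then show "deriv True F \<Gamma> G"
    using derivK_imp_deriv_subst[of F \<Gamma> G Var] by (simp add: subst_fm_Var_id)
next
  assume "deriv True F \<Gamma> G"
  then show "derivK F \<Gamma> G"
  proof (induction rule: deriv.induct)
    case (axiom p ts \<Gamma>)
    then show ?case using K_axiom by (metis insert_DiffM)
  qed (auto intro: right_ruleK left_ruleK)
qed

lemma derivD_iff_deriv: "derivD F \<Gamma> G \<longleftrightarrow> deriv False F \<Gamma> G"
proof
  assume "derivD F \<Gamma> G"
  then show "deriv False F \<Gamma> G"
    using derivD_imp_deriv_subst[of F \<Gamma> G Var] by (simp add: subst_fm_Var_id)
next
  assume "deriv False F \<Gamma> G"
  then show "derivD F \<Gamma> G"
  proof (induction rule: deriv.induct)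
    case (axiom p ts \<Gamma>)
    then show ?case using D_axiom by (metis insert_DiffM)
  qed (auto intro: right_ruleD left_ruleD)
qed

theorem theorem6:
  fixes F :: "('f \<times> nat) set" and P :: "('p \<times> nat) set"
    and \<Gamma> :: "('f, 'p) fm multiset" and G :: "('f, 'p) fm"
  assumes "\<forall>A\<in>#\<Gamma>. wf_fm F P A" and "wf_fm F P G"
  shows "derivD F \<Gamma> G \<longleftrightarrow> derivK F \<Gamma> G"
  using deriv_False_imp_True deriv_True_imp_False by (auto simp: derivD_iff_deriv derivK_iff_deriv)

end
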